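(* Let $G$ be a finite group with identity $e$. (1) There exist $d\ge 1$ and a linear representation (group homomorphism) $\psi:G\to\mathrm{GL}_d(\mathbb{C})$ such that $$\kappa(G)=\min_{g\in G\setminus\{e\}}\rho_d(\psi(g),\mathrm{Id})$$ (with the convention that the minimum over the empty set is $1$). In particular, $\kappa(G)$ is a rational number. (2) $\kappa(G)=1$ if and only if $G$ has a fixed-point free complex representation. (3) Let $\mathbb{Z}_p$ denote the cyclic group of order $p$. For every prime $p$ and every $n\ge 2$, $$\kappa(\mathbb{Z}_p^n)=\frac{p^n-p^{n-1}}{p^n-1}.$$ In particular, $\kappa(\mathbb{Z}_2^n)\to 1/2$ as $n\to\infty$.
   Context: For $d\ge1$ and $d\times d$ complex matrices $A,B$, put $\rho_d(A,B)=\frac1d\operatorname{rank}(A-B)$. For $0<\kappa\le1$, a countable group $G$ with identity $e$ is $\kappa$-linear sofic over $\mathbb{C}$ if for every finite set $S\subseteq G$, every $\delta>0$ and every $0\le\kappa'<\kappa$ there exist $d\ge1$ and a map $\phi:S\to\mathrm{GL}_d(\mathbb{C})$ such that: (AH) for all $g,h\in S$ with $gh\in S$, $\rho_d(\phi(gh),\phi(g)\phi(h))<\delta$; (D) for all $g\in S\setminus\{e\}$, $\rho_d(\phi(g),\mathrm{Id})\ge\kappa'$. Define $\kappa(G)$ to be the supremum of all $\kappa\in(0,1]$ such that $G$ is $\kappa$-linear sofic over $\mathbb{C}$, and $\kappa(G)=0$ if there is no such $\kappa$. A complex representation $\psi:G\to\mathrm{GL}_d(\mathbb{C})$, $d\ge1$,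 is fixed-point free if for every $g\neq e$ the matrix $\psi(g)$ does not have $1$ as an eigenvalue. *)

theory Defs
  imports
    "HOL-Algebra.Elementary_Groups"
    "HOL-Algebra.Product_Groups"
    "HOL-Computational_Algebra.Primes"
    "Jordan_Normal_Form.DL_Rank"
    "Jordan_Normal_Form.Char_Poly"
begin

definition GL :: "nat \<Rightarrow> complex mat monoid" where
  "GL d = units_of (ring_mat TYPE(complex) d ())"

lemma carrier_GL: "carrier (GL d) = {A \<in> carrier_mat d d. invertible_mat A}"
proof (intro Set.equalityI Set.subsetI)
  fix A :: "complex mat"
  assume "A \<in> carrier (GL d)"
  then show "A \<in> {A \<in> carrier_mat d d. invertible_mat A}"
    by (auto simp: GL_def units_of_def Units_def ring_mat_def
        invertible_mat_def inverts_mat_def)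
next
  fix A :: "complex mat"
  assume "A \<in> {A \<in> carrier_mat d d. invertible_mat A}"
  then obtain B where A: "A \<in> carrier_mat d d"
    and AB: "A * B = 1\<^sub>m d" and BA: "B * A = 1\<^sub>m (dim_row B)"
    by (auto simp: invertible_mat_def inverts_mat_def)
  have "dim_col B = d"
    using arg_cong[OF AB, of dim_col] by simp
  moreover have "dim_row B = d"
    using arg_cong[OF BA, of dim_col] A by simp
  ultimately have "B \<in> carrier_mat d d" "B * A = 1\<^sub>m d"
    using BA by auto
  with A AB show "A \<in> carrier (GL d)"
    by (auto simp: GL_def units_of_def Units_def ring_mat_def)
qed

lemma mult_GL [simp]: "A \<otimes>\<^bsub>GL d\<^esub> B = A * B"
  by (simp add: GL_def units_of_def ring_mat_def)

lemma one_GL [simp]: "\<one>\<^bsub>GL d\<^esub> = 1\<^sub>m d"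
  by (simp add: GL_def units_of_def ring_mat_def)

definition rank_dist :: "nat \<Rightarrow> complex mat \<Rightarrow> complex mat \<Rightarrow> real" where
  "rank_dist d A B = real (vec_space.rank d (A - B)) / real d"

text \<open>
  Intended for countable groups and \<open>0 < \<kappa> \<le> 1\<close>; these side conditions are not built into the
  definition. Only the values of \<open>\<phi>\<close> on \<open>S\<close> are constrained, so \<open>\<phi>\<close> encodes a map with domain \<open>S\<close>.
\<close>

definition linear_sofic :: "('a, 'b) monoid_scheme \<Rightarrow> real \<Rightarrow> bool" where
  "linear_sofic G \<kappa> \<longleftrightarrow>
    (\<forall>S \<delta> \<kappa>'. finite S \<and> S \<subseteq> carrier G \<and> 0 < \<delta> \<and> 0 \<le> \<kappa>' \<and> \<kappa>' < \<kappa> \<longrightarrow>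
      (\<exists>d\<ge>1. \<exists>\<phi>. \<phi> \<in> S \<rightarrow> carrier (GL d) \<and>
        (\<forall>g\<in>S. \<forall>h\<in>S. g \<otimes>\<^bsub>G\<^esub> h \<in> S \<longrightarrow>
          rank_dist d (\<phi> (g \<otimes>\<^bsub>G\<^esub> h)) (\<phi> g * \<phi> h) < \<delta>) \<and>
        (\<forall>g\<in>S - {\<one>\<^bsub>G\<^esub>}. rank_dist d (\<phi> g) (1\<^sub>m d) \<ge> \<kappa>')))"

definition sofic_kappa :: "('a, 'b) monoid_scheme \<Rightarrow> real" where
  "sofic_kappa G =
    (let K = {\<kappa>. 0 < \<kappa> \<and> \<kappa> \<le> 1 \<and> linear_sofic G \<kappa>}
     in if K = {} then 0 else Sup K)"

definition representation ::
    "('a, 'b) monoid_scheme \<Rightarrow> nat \<Rightarrow> ('a \<Rightarrow> complex mat) \<Rightarrow> bool" where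
  "representation G d \<psi> \<longleftrightarrow> d \<ge> 1 \<and> \<psi> \<in> hom G (GL d)"

definition fixed_point_free ::
    "('a, 'b) monoid_scheme \<Rightarrow> ('a \<Rightarrow> complex mat) \<Rightarrow> bool" where
  "fixed_point_free G \<psi> \<longleftrightarrow> (\<forall>g\<in>carrier G - {\<one>\<^bsub>G\<^esub>}. \<not> eigenvalue (\<psi> g) 1)"

text \<open>The minimum over the empty set, which arises for the trivial group, is 1 by convention.\<close>

definition min_rank_dist ::
    "('a, 'b) monoid_scheme \<Rightarrow> nat \<Rightarrow> ('a \<Rightarrow> complex mat) \<Rightarrow> real" where
  "min_rank_dist G d \<psi> =
    (if carrier G - {\<one>\<^bsub>G\<^esub>} = {} then 1
     else Min ((\<lambda>g. rank_dist d (\<psi> g) (1\<^sub>m d)) ` (carrier G - {\<one>\<^bsub>G\<^esub>})))"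

definition cyclic_power :: "nat \<Rightarrow> nat \<Rightarrow> (nat \<Rightarrow> int) monoid" where
  "cyclic_power p n = product_group {..<n} (\<lambda>_. integer_mod_group p)"

end

theory Submission
  imports Defs "HOL-Algebra.Multiplicative_Group"
begin

text \<open>
  For a finite group \<open>G\<close> the constant \<open>\<kappa>(G)\<close> is the largest value of
  \<open>min\<^bsub>g \<noteq> e\<^esub> rank(\<psi>(g) - Id) / d\<close> over all genuine representations \<open>\<psi>\<close> of \<open>G\<close>.

  One inequality is clear, since a representation is an approximate one with error \<open>0\<close>.  For the
  other, take maps \<open>\<phi>(g)\<close> that are multiplicative up to rank \<open>\<delta> d\<close>.  The vectors \<open>v\<close> with
  \<open>\<phi>(e) v = v\<close> and \<open>\<phi>(gh) \<phi>(k) v = \<phi>(g) \<phi>(h) \<phi>(k) v\<close> for all \<open>g, h, k\<close> form a subspace of codimension at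
  most \<open>(|G|\<^sup>3 + 1) \<delta> d\<close>.  It is invariant under \<open>\<phi>\<close>, and \<open>\<phi>\<close> restricts there to a representation whose
  ranks have dropped by no more than this codimension (\<open>almost_representation_restricts\<close>).

  The supremum over representations is attained.  If \<open>A\<close> has finite order then \<open>rank(A - Id)\<close> is
  determined by the traces of the powers of \<open>A\<close> (\<open>rank_diff_one_finite_order\<close>), so the ranks of a
  representation depend only on its character and add up along subrepresentations and quotients.
  Every representation of dimension above \<open>|G|\<close> has a proper invariant subspace, so rank data of
  representations are exactly the nonzero non-negative integer combinations of the finitely many
  rank data that occur in dimensions up to \<open>|G|\<close>.  Maximizing the minimal normalized rank over such
  combinations is a matrix game with rational payoffs; Fourier--Motzkin elimination over the
  rationals shows that its value is rational and attained by rational weights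
  (\<open>optimal_weights_exist\<close>), hence by a representation.  The regular representation shows that the
  value is positive.  The characterization of \<open>\<kappa>(G) = 1\<close> is then immediate: the rank of \<open>\<psi>(g) - Id\<close> is full
  if and only if \<open>1\<close> is not an eigenvalue.

  For an abelian group of exponent \<open>p\<close> the map \<open>g \<mapsto> \<psi>(g\<^sup>k)\<close> is again a representation, so its character
  has a non-negative sum; this bounds the sum of all \<open>rank(\<psi>(g) - Id)\<close> by \<open>d (|G| - |G|/p)\<close> and thus the
  minimum by the average over \<open>g \<noteq> e\<close>.  The regular representation minus the trivial one has all ranks
  equal and meets this bound (\<open>sofic_kappa_elementary_abelian\<close>).

  Linear algebra is done with matrices only: subspaces and quotients appear as pairs of matrices
  \<open>B\<close>, \<open>L\<close> with \<open>L B = Id\<close>, the columns of \<open>B\<close> being a basis and \<open>L\<close> reading off coordinates.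
\<close>

section \<open>Matrix algebra and full-rank factorizations\<close>

text \<open>
  The ring laws are stated with equations between dimensions as side conditions.  In this form the
  simplifier can discharge them for rectangular matrices, whereas carrier conditions would leave it
  to guess the intermediate dimension.
\<close>

lemma mult_mat_assoc:
  "dim_col A = dim_row B \<Longrightarrow> dim_col B = dim_row C \<Longrightarrow>
    (A * B) * C = A * (B * (C :: 'a :: semiring_0 mat))"
  by (rule assoc_mult_mat[of _ "dim_row A" "dim_col A" _ "dim_col B" _ "dim_col C"]) auto

lemma mult_mat_add_right:
  "dim_col A = dim_row B \<Longrightarrow> dim_row B = dim_row C \<Longrightarrow> dim_col B = dim_col C \<Longrightarrow>
    A * (B + C) = A * B + A * (C :: 'a :: semiring_0 mat)"
  by (rule mult_add_distrib_mat[of _ "dim_row A" "dim_col A" _ "dim_col B"]) auto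

lemma mult_mat_diff_right:
  "dim_col A = dim_row B \<Longrightarrow> dim_row B = dim_row C \<Longrightarrow> dim_col B = dim_col C \<Longrightarrow>
    A * (B - C) = A * B - A * (C :: 'a :: ring mat)"
  by (rule mult_minus_distrib_mat[of _ "dim_row A" "dim_col A" _ "dim_col B"]) auto

lemma mult_mat_diff_left:
  "dim_row A = dim_row B \<Longrightarrow> dim_col A = dim_col B \<Longrightarrow> dim_col B = dim_row C \<Longrightarrow>
    (A - B) * C = A * C - B * (C :: 'a :: ring mat)"
  by (rule minus_mult_distrib_mat[of _ "dim_row A" "dim_col A" _ _ "dim_col C"]) auto

lemma one_mult_mat: "dim_row A = n \<Longrightarrow> 1\<^sub>m n * A = (A :: 'a :: semiring_1 mat)"
  by (rule left_mult_one_mat) auto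

lemma mult_one_mat: "dim_col A = n \<Longrightarrow> A * 1\<^sub>m n = (A :: 'a :: semiring_1 mat)"
  by (rule right_mult_one_mat) auto

lemma diff_zero_mat: "dim_row A = n \<Longrightarrow> dim_col A = m \<Longrightarrow> A - 0\<^sub>m n m = (A :: 'a :: ab_group_add mat)"
  by (intro eq_matI) auto

lemma zero_mult_mat: "dim_row A = m \<Longrightarrow> 0\<^sub>m n m * A = (0\<^sub>m n (dim_col A) :: 'a :: semiring_0 mat)"
  by (rule left_mult_zero_mat) auto

lemma mult_zero_mat: "dim_col A = n \<Longrightarrow> A * 0\<^sub>m n m = (0\<^sub>m (dim_row A) m :: 'a :: semiring_0 mat)"
  by (rule right_mult_zero_mat) auto

lemmas mat_algebra = mult_mat_assoc mult_mat_add_right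
  mult_mat_diff_right mult_mat_diff_left one_mult_mat mult_one_mat diff_zero_mat
  zero_mult_mat mult_zero_mat

text \<open>
  A factorization through dimension \<open>r\<close> with a left inverse of \<open>X\<close> and a right inverse of \<open>Y\<close>.  They
  allow \<open>X\<close> to be cancelled on the left and \<open>Y\<close> on the right, which replaces every argument about
  bases of images and kernels.
\<close>

definition full_rank_factors ::
    "nat \<Rightarrow> nat \<Rightarrow> nat \<Rightarrow> 'a :: field mat \<Rightarrow> 'a mat \<Rightarrow> 'a mat \<Rightarrow> 'a mat \<Rightarrow> 'a mat \<Rightarrow> bool" where
  "full_rank_factors n m r A X Y X' Y' \<longleftrightarrow>
    X \<in> carrier_mat n r \<and> Y \<in> carrier_mat r m \<and> X' \<in> carrier_mat r n \<and> Y' \<in> carrier_mat m r \<and>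
    A = X * Y \<and> X' * X = 1\<^sub>m r \<and> Y * Y' = 1\<^sub>m r"

text \<open>
  One step of Gaussian elimination read backwards.  The row \<open>e\<close> and the column \<open>f\<close> separate \<open>u\<close> and \<open>v\<close>
  from the image and the coimage of \<open>A\<close>, so \<open>u\<close> and \<open>v\<close> can be adjoined to the factors; the old
  one-sided inverses are corrected so that they annihilate \<open>u\<close> and \<open>v\<close>.
\<close>

lemma full_rank_factors_add_rank_one:
  fixes A :: "'a :: field mat"
  assumes frf: "full_rank_factors n m r A X Y X' Y'"
    and u: "u \<in> carrier_mat n 1" and v: "v \<in> carrier_mat 1 m"
    and e: "e \<in> carrier_mat 1 n" and f: "f \<in> carrier_mat m 1"
    and eu: "e * u = 1\<^sub>m 1" and vf: "v * f = 1\<^sub>m 1"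
    and eA: "e * A = 0\<^sub>m 1 m" and Af: "A * f = 0\<^sub>m n 1"
  shows "\<exists>X Y X' Y'. full_rank_factors n m (1 + r) (u * v + A) X Y X' Y'"
proof -
  from frf have X: "X \<in> carrier_mat n r" and Y: "Y \<in> carrier_mat r m"
    and X': "X' \<in> carrier_mat r n" and Y': "Y' \<in> carrier_mat m r"
    and A: "A = X * Y" and XX: "X' * X = 1\<^sub>m r" and YY: "Y * Y' = 1\<^sub>m r"
    by (auto simp: full_rank_factors_def)
  note dims = carrier_matD[OF X] carrier_matD[OF Y] carrier_matD[OF X'] carrier_matD[OF Y']
    carrier_matD[OF u] carrier_matD[OF v] carrier_matD[OF e] carrier_matD[OF f]
  have "e * X = (e * A) * Y'"
    unfolding A using YY by (simp add: mat_algebra dims)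
  hence eX: "e * X = 0\<^sub>m 1 r" using eA Y' by simp
  have "Y * f = X' * (A * f)"
    unfolding A using XX by (simp add: mult_mat_assoc[symmetric] one_mult_mat dims)
  hence Yf: "Y * f = 0\<^sub>m r 1" using Af X' by simp
  \<comment> \<open>The blocks with no rows or no columns only serve to place \<open>u\<close> next to \<open>X\<close> and \<open>v\<close> on top of \<open>Y\<close>.\<close>
  define X2 where "X2 = four_block_mat u X (0\<^sub>m 0 1) (0\<^sub>m 0 r)"
  define Y2 where "Y2 = four_block_mat v (0\<^sub>m 1 0) Y (0\<^sub>m r 0)"
  define X2' where "X2' = four_block_mat e (0\<^sub>m 1 0) (X' - (X' * u) * e) (0\<^sub>m r 0)"
  define Y2' where "Y2' = four_block_mat f (Y' - f * (v * Y')) (0\<^sub>m 0 1) (0\<^sub>m 0 r)"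
  have XuE: "X' - (X' * u) * e \<in> carrier_mat r n" and YfE: "Y' - f * (v * Y') \<in> carrier_mat m r"
    using X' u e Y' f v by auto
  have "X2 * Y2 = four_block_mat (u * v + X * Y) (0\<^sub>m n 0) (0\<^sub>m 0 m) (0\<^sub>m 0 0)"
    unfolding X2_def Y2_def
    by (subst mult_four_block_mat[of _ n 1 _ r _ 0 _ _ m _ 0]) (use u v X Y in auto)
  also have "\<dots> = u * v + A"
    unfolding A by (rule eq_matI) (use u v X Y in \<open>auto simp: four_block_mat_def Let_def\<close>)
  finally have 1: "u * v + A = X2 * Y2" by simp
  have a: "(X' - (X' * u) * e) * u = 0\<^sub>m r 1"
    using eu X' u by (simp add: mat_algebra dims)
  have b: "(X' - (X' * u) * e) * X = 1\<^sub>m r"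
    using eX XX X' u by (simp add: mat_algebra dims)
  have c: "v * (Y' - f * (v * Y')) = 0\<^sub>m 1 r"
  proof -
    have "v * (f * (v * Y')) = v * Y'"
      using vf by (simp add: mult_mat_assoc[symmetric] one_mult_mat dims)
    thus ?thesis using Y' v by (simp add: mat_algebra dims)
  qed
  have d: "Y * (Y' - f * (v * Y')) = 1\<^sub>m r"
  proof -
    have "Y * (f * (v * Y')) = (Y * f) * (v * Y')"
      by (simp add: mat_algebra dims)
    also have "\<dots> = 0\<^sub>m r r" unfolding Yf by (simp add: mat_algebra dims)
    finally show ?thesis using YY by (simp add: mat_algebra dims)
  qed
  have "X2' * X2 = four_block_mat (1\<^sub>m 1) (0\<^sub>m 1 r) (0\<^sub>m r 1) (1\<^sub>m r)"
    unfolding X2_def X2'_def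
    by (subst mult_four_block_mat[of _ 1 n _ 0 _ r _ _ 1 _ r]) (use u e X X' XuE a b eX eu in simp_all)
  also have "\<dots> = 1\<^sub>m (1 + r)" by (rule four_block_one_mat) 
  finally have 2: "X2' * X2 = 1\<^sub>m (1 + r)" .
  have "Y2 * Y2' = four_block_mat (1\<^sub>m 1) (0\<^sub>m 1 r) (0\<^sub>m r 1) (1\<^sub>m r)"
    unfolding Y2_def Y2'_def
    by (subst mult_four_block_mat[of _ 1 m _ 0 _ r _ _ 1 _ r]) (use v f Y Y' YfE c d Yf vf in simp_all)
  also have "\<dots> = 1\<^sub>m (1 + r)" by (rule four_block_one_mat) 
  finally have 3: "Y2 * Y2' = 1\<^sub>m (1 + r)" .
  have "X2 \<in> carrier_mat n (1 + r)" "Y2 \<in> carrier_mat (1 + r) m"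
    "X2' \<in> carrier_mat (1 + r) n" "Y2' \<in> carrier_mat m (1 + r)"
    by (auto intro!: carrier_matI simp: X2_def Y2_def X2'_def Y2'_def dims)
  with 1 2 3 have "full_rank_factors n m (1 + r) (u * v + A) X2 Y2 X2' Y2'"
    unfolding full_rank_factors_def by blast
  thus ?thesis by blast
qed

text \<open>
  Subtracting the rank one matrix through a nonzero entry clears the row and the column of that
  entry and makes no zero column nonzero, so the number of nonzero columns is a termination measure.
\<close>

lemma full_rank_factors_exist:
  fixes A :: "'a :: field mat"
  assumes "A \<in> carrier_mat n m"
  shows "\<exists>r X Y X' Y'. full_rank_factors n m r A X Y X' Y'"
  using assms
proof (induction "card {j. j < m \<and> col A j \<noteq> 0\<^sub>v n}" arbitrary: A rule: less_induct)
  case (less A)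
  note A = less.prems
  show ?case
  proof (cases "\<exists>i j. i < n \<and> j < m \<and> A $$ (i, j) \<noteq> 0")
    case False
    hence "A = 0\<^sub>m n m" using A by (intro eq_matI) auto
    hence "full_rank_factors n m 0 A (0\<^sub>m n 0) (0\<^sub>m 0 m) (0\<^sub>m 0 n) (0\<^sub>m m 0)"
      unfolding full_rank_factors_def by (auto intro!: eq_matI simp: scalar_prod_def)
    thus ?thesis by blast
  next
    case True
    then obtain i j where i: "i < n" and j: "j < m" and a: "A $$ (i, j) \<noteq> 0" by blast
    \<comment> \<open>\<open>u v\<close> agrees with \<open>A\<close> in row \<open>i\<close> and column \<open>j\<close>, which \<open>e\<close> and, up to a factor, \<open>f\<close> extract.\<close>
    define u where "u = mat n 1 (\<lambda>(k, _). A $$ (k, j) / A $$ (i, j))"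
    define v where "v = mat 1 m (\<lambda>(_, l). A $$ (i, l))"
    define e where "e = mat 1 n (\<lambda>(_, k). if k = i then 1 else 0 :: 'a)"
    define f where "f = mat m 1 (\<lambda>(l, _). if l = j then 1 / A $$ (i, j) else 0)"
    have u: "u \<in> carrier_mat n 1" and v: "v \<in> carrier_mat 1 m"
      and e: "e \<in> carrier_mat 1 n" and f: "f \<in> carrier_mat m 1"
      by (auto simp: u_def v_def e_def f_def)
    define B where "B = A - u * v"
    have B: "B \<in> carrier_mat n m" using A u v by (auto simp: B_def)
    have B_ij: "B $$ (k, l) = A $$ (k, l) - A $$ (k, j) / A $$ (i, j) * A $$ (i, l)"
      if "k < n" "l < m" for k l
      using that A u v by (simp add: B_def scalar_prod_def u_def v_def)
    have "{l. l < m \<and> col B l \<noteq> 0\<^sub>v n} \<subset> {l. l < m \<and> col A l \<noteq> 0\<^sub>v n}"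
    proof
      show "{l. l < m \<and> col B l \<noteq> 0\<^sub>v n} \<subseteq> {l. l < m \<and> col A l \<noteq> 0\<^sub>v n}"
      proof safe
        fix l assume l: "l < m" "col B l \<noteq> 0\<^sub>v n" "col A l = 0\<^sub>v n"
        have "A $$ (k, l) = 0" if "k < n" for k
          using arg_cong[OF l(3), of "\<lambda>w. w $ k"] that A l(1) by simp
        hence "col B l = 0\<^sub>v n" using l(1) B B_ij i by (intro eq_vecI) auto
        with l(2) show False by simp
      qed
      have "col A j $ i \<noteq> (0\<^sub>v n :: 'a vec) $ i" using a i j A by simp
      hence "col A j \<noteq> 0\<^sub>v n" by metis
      moreover have "col B j = 0\<^sub>v n"
        using j B B_ij a by (intro eq_vecI) auto
      ultimately show "{l. l < m \<and> col B l \<noteq> 0\<^sub>v n} \<noteq> {l. l < m \<and> col A l \<noteq> 0\<^sub>v n}"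
        using j by blast
    qed
    hence "card {l. l < m \<and> col B l \<noteq> 0\<^sub>v n} < card {l. l < m \<and> col A l \<noteq> 0\<^sub>v n}"
      by (intro psubset_card_mono) auto
    from less.hyps[OF this B] obtain r X Y X' Y'
      where frf: "full_rank_factors n m r B X Y X' Y'" by blast
    have eZ: "(e * Z) $$ (0, l) = Z $$ (i, l)" if "Z \<in> carrier_mat n c" "l < c" for Z c l
    proof -
      have "(e * Z) $$ (0, l) = (\<Sum>k<n. (if k = i then 1 else 0) * Z $$ (k, l))"
        using that by (simp add: e_def scalar_prod_def atLeast0LessThan)
      also have "\<dots> = (\<Sum>k<n. if k = i then Z $$ (k, l) else 0)" by (rule sum.cong) auto
      finally show ?thesis using i by simp
    qed
    have Zf: "(Z * f) $$ (k, 0) = Z $$ (k, j) / A $$ (i, j)" if "Z \<in> carrier_mat c m" "k < c" for Z c k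
    proof -
      have "(Z * f) $$ (k, 0) = (\<Sum>l<m. Z $$ (k, l) * (if l = j then 1 / A $$ (i, j) else 0))"
        using that by (simp add: f_def scalar_prod_def atLeast0LessThan)
      also have "\<dots> = (\<Sum>l<m. if l = j then Z $$ (k, l) / A $$ (i, j) else 0)" by (rule sum.cong) auto
      finally show ?thesis using j by simp
    qed
    have eu: "e * u = 1\<^sub>m 1"
      using e u i a eZ[OF u, of 0] by (intro eq_matI) (auto simp: u_def)
    have vf: "v * f = 1\<^sub>m 1"
      using v f j a Zf[OF v, of 0] by (intro eq_matI) (auto simp: v_def)
    have eB: "e * B = 0\<^sub>m 1 m"
      using e B i a eZ[OF B] B_ij by (intro eq_matI) auto
    have Bf: "B * f = 0\<^sub>m n 1"
      using f B j a Zf[OF B] B_ij by (intro eq_matI) auto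
    from full_rank_factors_add_rank_one[OF frf u v e f eu vf eB Bf]
    have "\<exists>X Y X' Y'. full_rank_factors n m (1 + r) (u * v + B) X Y X' Y'" .
    moreover have "u * v + B = A" using A u v unfolding B_def by (intro eq_matI) auto
    ultimately show ?thesis by (simp only:) blast
  qed
qed

text \<open>
  Left multiplication by \<open>L\<close> recovers \<open>w\<close> from \<open>X w\<close>, so the columns of \<open>X\<close> are distinct and
  independent.
\<close>

lemma left_invertible_rank:
  fixes X :: "'a :: field mat"
  assumes X: "X \<in> carrier_mat n r" and L: "L \<in> carrier_mat r n" and LX: "L * X = 1\<^sub>m r"
  shows "vec_space.rank n X = r" "r \<le> n"
proof -
  interpret vec_space "TYPE('a)" n .
  have L_inverts: "L *\<^sub>v (X *\<^sub>v w) = w" if "w \<in> carrier_vec r" for w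
    using that assoc_mult_mat_vec[OF L X that] LX by simp
  have dist: "distinct (cols X)"
    unfolding distinct_conv_nth
  proof safe
    fix i j assume ij: "i < length (cols X)" "j < length (cols X)" "i \<noteq> j" "cols X ! i = cols X ! j"
    hence i: "i < r" and j: "j < r" using X by auto
    have "col (L * X) i = col (L * X) j"
      using ij i j X L by (simp add: col_mult2[OF L X])
    hence "unit_vec r i = (unit_vec r j :: 'a vec)" using i j LX by simp
    thus False using i j ij(3) by (metis index_unit_vec(1) zero_neq_one)
  qed
  have indpt: "lin_indpt (set (cols X))"
  proof (rule ccontr)
    assume "\<not> lin_indpt (set (cols X))"
    then obtain w where "w \<in> carrier_vec r" "w \<noteq> 0\<^sub>v r" "X *\<^sub>v w = 0\<^sub>v n"
      using lin_depE[OF X _ dist] by blast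
    moreover from this L have "L *\<^sub>v (X *\<^sub>v w) = 0\<^sub>v r" by auto
    ultimately show False using L_inverts by metis
  qed
  show "rank X = r" by (rule lin_indpt_full_rank[OF X dist indpt])
  have "card (set (cols X)) \<le> dim"
    using cols_dim[of X] X by (intro li_le_dim(2) fin_dim indpt) auto
  thus "r \<le> n" using distinct_card[OF dist] X by (simp add: dim_is_n)
qed

text \<open>
  Because \<open>Y\<close> has a right inverse, \<open>A\<close> and \<open>X\<close> have the same column space.
\<close>

lemma full_rank_factors_rank:
  fixes A :: "'a :: field mat"
  assumes frf: "full_rank_factors n m r A X Y X' Y'"
  shows "vec_space.rank n A = r"
proof -
  interpret vec_space "TYPE('a)" n .
  from frf have X: "X \<in> carrier_mat n r" and Y: "Y \<in> carrier_mat r m"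
    and X': "X' \<in> carrier_mat r n" and Y': "Y' \<in> carrier_mat m r"
    and A: "A = X * Y" and XX: "X' * X = 1\<^sub>m r" and YY: "Y * Y' = 1\<^sub>m r"
    by (auto simp: full_rank_factors_def)
  have Ac: "A \<in> carrier_mat n m" using A X Y by auto
  have "X = A * Y'" unfolding A using X Y Y' YY by (simp add: mat_algebra)
  have "col_space A = col_space X"
  proof (intro equalityI subsetI)
    fix y assume "y \<in> col_space A"
    then obtain x where x: "x \<in> carrier_vec m" "y = A *\<^sub>v x" using col_space_eq[OF Ac] Ac by auto
    have "y = X *\<^sub>v (Y *\<^sub>v x)" using x X Y by (simp add: A)
    moreover have "Y *\<^sub>v x \<in> carrier_vec r" using Y x by simp
    ultimately show "y \<in> col_space X" using X by (auto simp: col_space_eq[OF X])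
  next
    fix y assume "y \<in> col_space X"
    then obtain x where x: "x \<in> carrier_vec r" "y = X *\<^sub>v x" using col_space_eq[OF X] X by auto
    have "y = A *\<^sub>v (Y' *\<^sub>v x)" using x Ac Y' \<open>X = A * Y'\<close> by simp
    moreover have "Y' *\<^sub>v x \<in> carrier_vec m" using Y' x by simp
    ultimately show "y \<in> col_space A" using Ac by (auto simp: col_space_eq[OF Ac])
  qed
  hence "rank A = rank X" unfolding rank_def col_space_def by simp
  thus ?thesis using left_invertible_rank(1)[OF X X' XX] by simp
qed

lemma obtain_full_rank_factors:
  fixes A :: "'a :: field mat"
  assumes A: "A \<in> carrier_mat n m" and r: "vec_space.rank n A = r"
  obtains X Y X' Y' where "X \<in> carrier_mat n r" "Y \<in> carrier_mat r m"
    "X' \<in> carrier_mat r n" "Y' \<in> carrier_mat m r"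
    "A = X * Y" "X' * X = 1\<^sub>m r" "Y * Y' = 1\<^sub>m r"
proof -
  obtain q X Y X' Y' where "full_rank_factors n m q A X Y X' Y'"
    using full_rank_factors_exist[OF A] by blast
  with full_rank_factors_rank[OF this] r show ?thesis
    using that unfolding full_rank_factors_def by blast
qed

text \<open>
  A full-rank factorization of the product exhibits the identity matrix of size \<open>rank (A B)\<close> as a
  product through dimension \<open>k\<close>.
\<close>

lemma rank_mult_le_inner:
  fixes A :: "'a :: field mat"
  assumes A: "A \<in> carrier_mat n k" and B: "B \<in> carrier_mat k m"
  shows "vec_space.rank n (A * B) \<le> k"
proof -
  define r where "r = vec_space.rank n (A * B)"
  have "A * B \<in> carrier_mat n m" using A B by simp
  then obtain X Y X' Y' where X: "X \<in> carrier_mat n r" and Y: "Y \<in> carrier_mat r m"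
    and X': "X' \<in> carrier_mat r n" and Y': "Y' \<in> carrier_mat m r"
    and AB: "A * B = X * Y" and XX: "X' * X = 1\<^sub>m r" and YY: "Y * Y' = 1\<^sub>m r"
    using obtain_full_rank_factors r_def by metis
  have "(X' * A) * (B * Y') = X' * ((A * B) * Y')"
    using X' A B Y' by (simp add: mat_algebra)
  also have "\<dots> = (X' * X) * (Y * Y')"
    unfolding AB using X' X Y Y' by (simp add: mat_algebra)
  also have "\<dots> = 1\<^sub>m r" unfolding XX YY by simp
  finally show ?thesis
    using left_invertible_rank(2)[of "B * Y'" k r "X' * A"] X' A B Y' by (simp add: r_def)
qed

lemma rank_mult_le_left:
  fixes A :: "'a :: field mat"
  assumes A: "A \<in> carrier_mat n k" and B: "B \<in> carrier_mat k m"
  shows "vec_space.rank n (A * B) \<le> vec_space.rank n A"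
proof -
  obtain r where r: "vec_space.rank n A = r" by simp
  obtain X Y X' Y' where X: "X \<in> carrier_mat n r" and Y: "Y \<in> carrier_mat r k" and XY: "A = X * Y"
    by (rule obtain_full_rank_factors[OF A r])
  have "A * B = X * (Y * B)" unfolding XY using X Y B by (simp add: mat_algebra)
  also have "vec_space.rank n \<dots> \<le> r"
    by (rule rank_mult_le_inner[OF X mult_carrier_mat[OF Y B]])
  finally show ?thesis using r by simp
qed

lemma rank_mult_le_right:
  fixes A :: "'a :: field mat"
  assumes A: "A \<in> carrier_mat n k" and B: "B \<in> carrier_mat k m"
  shows "vec_space.rank n (A * B) \<le> vec_space.rank k B"
proof -
  obtain r where r: "vec_space.rank k B = r" by simp
  obtain X Y X' Y' where X: "X \<in> carrier_mat k r" and Y: "Y \<in> carrier_mat r m" and XY: "B = X * Y"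
    by (rule obtain_full_rank_factors[OF B r])
  have "A * B = (A * X) * Y" unfolding XY using X Y A by (simp add: mat_algebra)
  also have "vec_space.rank n \<dots> \<le> r"
    by (rule rank_mult_le_inner[OF mult_carrier_mat[OF A X] Y])
  finally show ?thesis using r by simp
qed

lemma rank_eq_0:
  fixes A :: "'a :: field mat"
  assumes A: "A \<in> carrier_mat n m" and r: "vec_space.rank n A = 0"
  shows "A = 0\<^sub>m n m"
proof -
  obtain X Y X' Y' where X: "X \<in> carrier_mat n 0" and Y: "Y \<in> carrier_mat 0 m" and XY: "A = X * Y"
    by (rule obtain_full_rank_factors[OF A r])
  show ?thesis unfolding XY by (rule eq_matI) (use X Y in \<open>auto simp: scalar_prod_def\<close>)
qed

section \<open>Trace and idempotent matrices\<close>

definition mat_trace :: "'a :: comm_monoid_add mat \<Rightarrow> 'a" where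
  "mat_trace A = (\<Sum>i<dim_row A. A $$ (i, i))"

lemma mat_trace_diff:
  "A \<in> carrier_mat n n \<Longrightarrow> B \<in> carrier_mat n n \<Longrightarrow>
    mat_trace (A - B) = mat_trace A - (mat_trace B :: 'a :: ab_group_add)"
  by (simp add: mat_trace_def sum_subtractf)

lemma mat_trace_one [simp]: "mat_trace (1\<^sub>m n :: 'a :: semiring_1 mat) = of_nat n"
  by (simp add: mat_trace_def)

lemma mat_trace_mult_comm:
  assumes "A \<in> carrier_mat n m" "B \<in> carrier_mat m n"
  shows "mat_trace (A * B) = mat_trace (B * (A :: 'a :: comm_semiring_0 mat))"
proof -
  have "mat_trace (A * B) = (\<Sum>i<n. \<Sum>j<m. A $$ (i, j) * B $$ (j, i))"
    using assms by (auto simp: mat_trace_def scalar_prod_def atLeast0LessThan intro!: sum.cong)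
  also have "\<dots> = (\<Sum>j<m. \<Sum>i<n. B $$ (j, i) * A $$ (i, j))"
    by (subst sum.swap) (simp add: mult.commute)
  also have "\<dots> = mat_trace (B * A)"
    using assms by (auto simp: mat_trace_def scalar_prod_def atLeast0LessThan intro!: sum.cong)
  finally show ?thesis .
qed

text \<open>
  In a full-rank factorization \<open>P = X Y\<close> of an idempotent, cancelling \<open>X\<close> and \<open>Y\<close> in \<open>X Y X Y = X Y\<close>
  leaves \<open>Y X = Id\<close>.
\<close>

lemma idempotent_split:
  fixes P :: "'a :: field mat"
  assumes P: "P \<in> carrier_mat d d" and PP: "P * P = P" and r: "vec_space.rank d P = r"
  obtains B L where "B \<in> carrier_mat d r" "L \<in> carrier_mat r d" "B * L = P" "L * B = 1\<^sub>m r"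
proof -
  obtain X Y X' Y' where X: "X \<in> carrier_mat d r" and Y: "Y \<in> carrier_mat r d"
    and X': "X' \<in> carrier_mat r d" and Y': "Y' \<in> carrier_mat d r"
    and PXY: "P = X * Y" and XX: "X' * X = 1\<^sub>m r" and YY: "Y * Y' = 1\<^sub>m r"
    by (rule obtain_full_rank_factors[OF P r])
  have "Y * X = ((X' * X) * (Y * X)) * (Y * Y')"
    unfolding XX YY using X Y by (simp add: mat_algebra)
  also have "\<dots> = X' * (((X * Y) * (X * Y)) * Y')"
    using X Y X' Y' by (simp add: mat_algebra)
  also have "(X * Y) * (X * Y) = X * Y" using PP unfolding PXY .
  also have "X' * ((X * Y) * Y') = (X' * X) * (Y * Y')"
    using X Y X' Y' by (simp add: mat_algebra)
  also have "\<dots> = 1\<^sub>m r" unfolding XX YY by simp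
  finally show ?thesis using that[OF X Y] PXY by simp
qed

text \<open>
  The trace of \<open>B L\<close> is the trace of \<open>L B = Id\<close>.
\<close>

lemma rank_idempotent:
  fixes P :: "'a :: field mat"
  assumes P: "P \<in> carrier_mat d d" and PP: "P * P = P"
  shows "of_nat (vec_space.rank d P) = mat_trace P"
proof -
  obtain r where r: "vec_space.rank d P = r" by simp
  obtain B L where BL: "B \<in> carrier_mat d r" "L \<in> carrier_mat r d" "B * L = P" "L * B = 1\<^sub>m r"
    by (rule idempotent_split[OF assms r])
  show ?thesis using mat_trace_mult_comm[OF BL(1,2)] BL(3,4) r by simp
qed

lemma idempotent_complement:
  fixes P :: "'a :: ring_1 mat"
  assumes P: "P \<in> carrier_mat d d" and PP: "P * P = P"
  shows "(1\<^sub>m d - P) * (1\<^sub>m d - P) = 1\<^sub>m d - P"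
proof -
  have "(1\<^sub>m d - P) * (1\<^sub>m d - P) = (1\<^sub>m d - P) - (P - P)"
    using P PP by (simp add: mat_algebra)
  also have "\<dots> = 1\<^sub>m d - P" using P by (intro eq_matI) auto
  finally show ?thesis .
qed

lemma rank_le_dim:
  fixes A :: "'a :: field mat"
  assumes "A \<in> carrier_mat n m"
  shows "vec_space.rank n A \<le> n"
  using rank_mult_le_inner[of "1\<^sub>m n" n n A m] assms by auto

text \<open>
  Rank and trace agree for both idempotents, and traces subtract.
\<close>

lemma rank_complement:
  fixes P :: "'a :: field_char_0 mat"
  assumes P: "P \<in> carrier_mat d d" and PP: "P * P = P"
  shows "vec_space.rank d (1\<^sub>m d - P) = d - vec_space.rank d P"
proof -
  have C: "1\<^sub>m d - P \<in> carrier_mat d d" using P by (simp add: minus_carrier_mat)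
  have "(of_nat (vec_space.rank d (1\<^sub>m d - P)) :: 'a) = of_nat d - of_nat (vec_space.rank d P)"
    using rank_idempotent[OF C idempotent_complement[OF assms]] rank_idempotent[OF assms] P
    by (simp add: mat_trace_diff[OF one_carrier_mat P])
  also have "\<dots> = of_nat (d - vec_space.rank d P)"
    using rank_le_dim[OF P] by (simp add: of_nat_diff)
  finally show ?thesis by (simp only: of_nat_eq_iff)
qed

lemma rank_add_le:
  fixes A :: "'a :: field mat"
  assumes "A \<in> carrier_mat n m" "B \<in> carrier_mat n m"
  shows "vec_space.rank n (A + B) \<le> vec_space.rank n A + vec_space.rank n B"
  by (rule vec_space.rank_subadditive[OF assms])

section \<open>Common kernels\<close>

text \<open>
  The columns of \<open>B\<close> form a basis of the intersection of the kernels of the \<open>M i\<close>: any matrix \<open>C\<close> whose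
  columns lie in the intersection is \<open>B\<close> times its coordinate matrix \<open>L C\<close>.  Each further matrix costs at
  most its rank in dimension, since on the kernel found so far it factors as \<open>M i B = X Y\<close> and the
  idempotent \<open>Id - Y' Y\<close> projects onto the kernel of \<open>Y\<close>.
\<close>

lemma common_kernel_basis:
  fixes M :: "'i \<Rightarrow> 'a :: field_char_0 mat"
  assumes "finite I" "\<forall>i\<in>I. M i \<in> carrier_mat d d"
  shows "\<exists>m B L. B \<in> carrier_mat d m \<and> L \<in> carrier_mat m d \<and> L * B = 1\<^sub>m m \<and>
    (\<forall>i\<in>I. M i * B = 0\<^sub>m d m) \<and>
    (\<forall>c. \<forall>C\<in>carrier_mat d c. (\<forall>i\<in>I. M i * C = 0\<^sub>m d c) \<longrightarrow> B * (L * C) = C) \<and>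
    d \<le> m + (\<Sum>i\<in>I. vec_space.rank d (M i))"
  using assms
proof (induction I rule: finite_induct)
  case empty
  show ?case
    by (intro exI[of _ d] exI[of _ "1\<^sub>m d"]) auto
next
  case (insert i I)
  then obtain m B L where B: "B \<in> carrier_mat d m" and L: "L \<in> carrier_mat m d"
    and LB: "L * B = 1\<^sub>m m" and MB: "\<And>k. k \<in> I \<Longrightarrow> M k * B = 0\<^sub>m d m"
    and univ: "\<And>c C. C \<in> carrier_mat d c \<Longrightarrow> (\<And>k. k \<in> I \<Longrightarrow> M k * C = 0\<^sub>m d c) \<Longrightarrow> B * (L * C) = C"
    and dim: "d \<le> m + (\<Sum>k\<in>I. vec_space.rank d (M k))"
    by fastforce
  have Mi: "M i \<in> carrier_mat d d" and Mk: "\<And>k. k \<in> I \<Longrightarrow> M k \<in> carrier_mat d d"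
    using insert.prems by auto
  have MiB: "M i * B \<in> carrier_mat d m" using Mi B by simp
  obtain r where r: "vec_space.rank d (M i * B) = r" by simp
  obtain X Y X' Y' where X: "X \<in> carrier_mat d r" and Y: "Y \<in> carrier_mat r m"
    and X': "X' \<in> carrier_mat r d" and Y': "Y' \<in> carrier_mat m r"
    and XY: "M i * B = X * Y" and XX: "X' * X = 1\<^sub>m r" and YY: "Y * Y' = 1\<^sub>m r"
    by (rule obtain_full_rank_factors[OF MiB r])
  note dims = carrier_matD[OF X] carrier_matD[OF Y] carrier_matD[OF X'] carrier_matD[OF Y']
    carrier_matD[OF B] carrier_matD[OF L] carrier_matD[OF Mi]
  define Q where "Q = Y' * Y"
  have Q: "Q \<in> carrier_mat m m" using Y Y' by (simp add: Q_def)
  have "Q * Q = Y' * ((Y * Y') * Y)" by (simp add: Q_def mat_algebra dims)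
  hence QQ: "Q * Q = Q" unfolding YY using Y by (simp add: Q_def mat_algebra)
  have YQ: "Y * Q = Y"
  proof -
    have "Y * Q = (Y * Y') * Y" by (simp add: Q_def mat_algebra dims)
    thus ?thesis unfolding YY by (simp add: mat_algebra dims)
  qed
  have "vec_space.rank m Q \<le> r" unfolding Q_def by (rule rank_mult_le_inner[OF Y' Y])
  moreover have "vec_space.rank m (1\<^sub>m m - Q) = m - vec_space.rank m Q"
    by (rule rank_complement[OF Q QQ])
  moreover obtain m2 where m2: "vec_space.rank m (1\<^sub>m m - Q) = m2" by simp
  ultimately have m2_ge: "m \<le> m2 + r" by simp
  have Qc: "1\<^sub>m m - Q \<in> carrier_mat m m" using Q by (rule minus_carrier_mat)
  obtain B2 L2 where B2: "B2 \<in> carrier_mat m m2" and L2: "L2 \<in> carrier_mat m2 m"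
    and BL2: "B2 * L2 = 1\<^sub>m m - Q" and LB2: "L2 * B2 = 1\<^sub>m m2"
    by (rule idempotent_split[OF Qc idempotent_complement[OF Q QQ] m2])
  note dims2 = dims carrier_matD[OF B2] carrier_matD[OF L2] carrier_matD[OF Q]
  have YB2: "Y * B2 = 0\<^sub>m r m2"
  proof -
    have "Y * B2 = (Y * (B2 * L2)) * B2" using LB2 by (simp add: mat_algebra dims2)
    also have "Y * (B2 * L2) = 0\<^sub>m r m" unfolding BL2 using Y by (simp add: mat_algebra dims2 YQ)
    finally show ?thesis by (simp add: mat_algebra dims2)
  qed
  show ?case
  proof (intro exI conjI ballI allI impI)
    show "B * B2 \<in> carrier_mat d m2" "L2 * L \<in> carrier_mat m2 d" using B L B2 L2 by auto
    have "L2 * L * (B * B2) = L2 * ((L * B) * B2)" by (simp add: mat_algebra dims2)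
    thus "L2 * L * (B * B2) = 1\<^sub>m m2" unfolding LB using LB2 by (simp add: mat_algebra dims2)
    show "M k * (B * B2) = 0\<^sub>m d m2" if "k \<in> insert i I" for k
    proof (cases "k = i")
      case True
      have "M k * (B * B2) = (M i * B) * B2" using True by (simp add: mat_algebra dims2)
      also have "\<dots> = X * (Y * B2)" unfolding XY by (simp add: mat_algebra dims2)
      finally show ?thesis unfolding YB2 by (simp add: mat_algebra dims2)
    next
      case False
      hence k: "k \<in> I" using that by simp
      have "M k * (B * B2) = (M k * B) * B2" using Mk[OF k] by (simp add: mat_algebra dims2)
      thus ?thesis unfolding MB[OF k] by (simp add: mat_algebra dims2)
    qed
    show "B * B2 * (L2 * L * C) = C"
      if C: "C \<in> carrier_mat d c" and MC: "\<forall>k\<in>insert i I. M k * C = 0\<^sub>m d c" for c C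
    proof -
      note dC = carrier_matD[OF C]
      have BLC: "B * (L * C) = C" using univ[OF C] MC by simp
      have "Y * (L * C) = (X' * X) * (Y * (L * C))" unfolding XX by (simp add: mat_algebra dims2 dC)
      also have "\<dots> = X' * ((X * Y) * (L * C))" by (simp add: mat_algebra dims2 dC)
      also have "(X * Y) * (L * C) = M i * (B * (L * C))" 
        unfolding XY[symmetric] by (simp add: mat_algebra dims2 dC)
      also have "\<dots> = 0\<^sub>m d c" unfolding BLC using MC by simp
      finally have YLC: "Y * (L * C) = 0\<^sub>m r c" by (simp add: mat_algebra dims2 dC)
      have "B * B2 * (L2 * L * C) = B * ((B2 * L2) * (L * C))" by (simp add: mat_algebra dims2 dC)
      also have "(B2 * L2) * (L * C) = L * C - Y' * (Y * (L * C))"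
        unfolding BL2 Q_def by (simp add: mat_algebra dims2 dC)
      also have "\<dots> = L * C" unfolding YLC by (simp add: mat_algebra dims2 dC)
      finally show ?thesis unfolding BLC .
    qed
    have "r \<le> vec_space.rank d (M i)" using rank_mult_le_left[OF Mi B] r by simp
    thus "d \<le> m2 + (\<Sum>k\<in>insert i I. vec_space.rank d (M k))"
      using insert.hyps dim m2_ge by simp
  qed
qed

section \<open>Averages and matrices of finite order\<close>

text \<open>
  The entries outside the \<open>d\<close> by \<open>d\<close> block of a summand are ignored; fixing the dimension in advance
  gives the empty sum its size.
\<close>

definition mat_sum :: "nat \<Rightarrow> ('i \<Rightarrow> 'a :: comm_monoid_add mat) \<Rightarrow> 'i set \<Rightarrow> 'a mat" where
  "mat_sum d f I = mat d d (\<lambda>ij. \<Sum>k\<in>I. f k $$ ij)"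

lemma mat_sum_carrier [simp]: "mat_sum d f I \<in> carrier_mat d d"
  by (simp add: mat_sum_def)

lemma mat_sum_dim [simp]: "dim_row (mat_sum d f I) = d" "dim_col (mat_sum d f I) = d"
  by (simp_all add: mat_sum_def)

lemma mat_sum_index: "i < d \<Longrightarrow> j < d \<Longrightarrow> mat_sum d f I $$ (i, j) = (\<Sum>k\<in>I. f k $$ (i, j))"
  by (simp add: mat_sum_def)

lemma mat_sum_cong: "(\<And>k. k \<in> I \<Longrightarrow> f k = g k) \<Longrightarrow> mat_sum d f I = mat_sum d g I"
  by (simp add: mat_sum_def)

lemma mat_sum_reindex:
  assumes "bij_betw h I J"
  shows "mat_sum d (\<lambda>k. f (h k)) I = mat_sum d f J"
  by (rule eq_matI) (auto simp: mat_sum_index intro!: sum.reindex_bij_betw[OF assms])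

lemma mult_mat_sum:
  fixes f :: "'i \<Rightarrow> 'a :: semiring_0 mat"
  assumes A: "A \<in> carrier_mat d d" and f: "\<And>k. k \<in> I \<Longrightarrow> f k \<in> carrier_mat d d"
  shows "A * mat_sum d f I = mat_sum d (\<lambda>k. A * f k) I"
proof (rule eq_matI)
  fix i j assume "i < dim_row (mat_sum d (\<lambda>k. A * f k) I)" "j < dim_col (mat_sum d (\<lambda>k. A * f k) I)"
  hence ij: "i < d" "j < d" by auto
  have "(A * mat_sum d f I) $$ (i, j) = (\<Sum>l<d. A $$ (i, l) * (\<Sum>k\<in>I. f k $$ (l, j)))"
    using A ij by (auto simp: scalar_prod_def atLeast0LessThan mat_sum_index intro!: sum.cong)
  also have "\<dots> = (\<Sum>k\<in>I. \<Sum>l<d. A $$ (i, l) * f k $$ (l, j))"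
    unfolding sum_distrib_left by (rule sum.swap)
  also have "\<dots> = (\<Sum>k\<in>I. (A * f k) $$ (i, j))"
  proof (rule sum.cong)
    fix k assume "k \<in> I"
    from carrier_matD[OF f[OF this]] show "(\<Sum>l<d. A $$ (i, l) * f k $$ (l, j)) = (A * f k) $$ (i, j)"
      using A ij by (simp add: scalar_prod_def atLeast0LessThan)
  qed simp
  finally show "(A * mat_sum d f I) $$ (i, j) = mat_sum d (\<lambda>k. A * f k) I $$ (i, j)"
    using ij by (simp add: mat_sum_index)
qed (use A in auto)

lemma mat_sum_mult:
  fixes f :: "'i \<Rightarrow> 'a :: semiring_0 mat"
  assumes A: "A \<in> carrier_mat d d" and f: "\<And>k. k \<in> I \<Longrightarrow> f k \<in> carrier_mat d d"
  shows "mat_sum d f I * A = mat_sum d (\<lambda>k. f k * A) I"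
proof (rule eq_matI)
  fix i j assume "i < dim_row (mat_sum d (\<lambda>k. f k * A) I)" "j < dim_col (mat_sum d (\<lambda>k. f k * A) I)"
  hence ij: "i < d" "j < d" by auto
  have "(mat_sum d f I * A) $$ (i, j) = (\<Sum>l<d. (\<Sum>k\<in>I. f k $$ (i, l)) * A $$ (l, j))"
    using A ij by (auto simp: scalar_prod_def atLeast0LessThan mat_sum_index intro!: sum.cong)
  also have "\<dots> = (\<Sum>k\<in>I. \<Sum>l<d. f k $$ (i, l) * A $$ (l, j))"
    unfolding sum_distrib_right by (rule sum.swap)
  also have "\<dots> = (\<Sum>k\<in>I. (f k * A) $$ (i, j))"
  proof (rule sum.cong)
    fix k assume "k \<in> I"
    from carrier_matD[OF f[OF this]] show "(\<Sum>l<d. f k $$ (i, l) * A $$ (l, j)) = (f k * A) $$ (i, j)"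
      using A ij by (simp add: scalar_prod_def atLeast0LessThan)
  qed simp
  finally show "(mat_sum d f I * A) $$ (i, j) = mat_sum d (\<lambda>k. f k * A) I $$ (i, j)"
    using ij by (simp add: mat_sum_index)
qed (use A in auto)

lemma mat_trace_sum:
  assumes "\<And>k. k \<in> I \<Longrightarrow> f k \<in> carrier_mat d d"
  shows "mat_trace (mat_sum d f I) = (\<Sum>k\<in>I. mat_trace (f k))"
proof -
  have "mat_trace (mat_sum d f I) = (\<Sum>i<d. \<Sum>k\<in>I. f k $$ (i, i))"
    by (simp add: mat_trace_def mat_sum_index)
  also have "\<dots> = (\<Sum>k\<in>I. \<Sum>i<d. f k $$ (i, i))" by (rule sum.swap)
  also have "\<dots> = (\<Sum>k\<in>I. mat_trace (f k))"
    using assms by (intro sum.cong) (auto simp: mat_trace_def dest: carrier_matD)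
  finally show ?thesis .
qed

lemma mat_sum_const:
  fixes A :: "'a :: semiring_1 mat"
  assumes "A \<in> carrier_mat d d"
  shows "mat_sum d (\<lambda>_. A) I = of_nat (card I) \<cdot>\<^sub>m A"
  using assms by (intro eq_matI) (auto simp: mat_sum_index)

lemma rank_mat_sum_le:
  fixes f :: "'i \<Rightarrow> 'a :: field mat"
  assumes "finite I" "\<And>k. k \<in> I \<Longrightarrow> f k \<in> carrier_mat d d"
  shows "vec_space.rank d (mat_sum d f I) \<le> (\<Sum>k\<in>I. vec_space.rank d (f k))"
  using assms
proof (induction I rule: finite_induct)
  case empty
  have "mat_sum d f {} = 0\<^sub>m d d" by (intro eq_matI) (auto simp: mat_sum_index)
  thus ?case by (simp add: vec_space.rank_0I)
next
  case (insert i I)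
  have f: "f i \<in> carrier_mat d d" using insert.prems by simp
  have "mat_sum d f (insert i I) = f i + mat_sum d f I"
    using insert.hyps f by (intro eq_matI) (auto simp: mat_sum_index)
  thus ?case using rank_add_le[OF f mat_sum_carrier, of f I] insert by simp
qed

text \<open>
  If right multiplication by each summand fixes the sum \<open>S\<close>, then \<open>S S\<close> is \<open>|I|\<close> times \<open>S\<close>.
\<close>

lemma average_idempotent:
  fixes f :: "'i \<Rightarrow> 'a :: field_char_0 mat"
  assumes I: "finite I" "I \<noteq> {}" and f: "\<And>k. k \<in> I \<Longrightarrow> f k \<in> carrier_mat d d"
    and S: "\<And>k. k \<in> I \<Longrightarrow> mat_sum d f I * f k = mat_sum d f I"
    and E: "E = inverse (of_nat (card I)) \<cdot>\<^sub>m mat_sum d f I"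
  shows "E \<in> carrier_mat d d" "E * E = E"
    "of_nat (vec_space.rank d E) = (\<Sum>k\<in>I. mat_trace (f k)) / of_nat (card I)"
proof -
  have card: "(of_nat (card I) :: 'a) \<noteq> 0" using I by simp
  show Ec: "E \<in> carrier_mat d d" by (simp add: E)
  have "mat_sum d f I * mat_sum d f I = mat_sum d (\<lambda>k. mat_sum d f I * f k) I"
    by (rule mult_mat_sum) (use f in auto)
  also have "\<dots> = mat_sum d (\<lambda>k. mat_sum d f I) I"
    by (rule mat_sum_cong) (rule S)
  also have "\<dots> = of_nat (card I) \<cdot>\<^sub>m mat_sum d f I"
    by (rule mat_sum_const) simp
  finally have SS: "mat_sum d f I * mat_sum d f I = of_nat (card I) \<cdot>\<^sub>m mat_sum d f I" .
  have "E * E = inverse (of_nat (card I)) \<cdot>\<^sub>m (inverse (of_nat (card I)) \<cdot>\<^sub>m (mat_sum d f I * mat_sum d f I))"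
    unfolding E by (simp add: mult_smult_assoc_mat[OF mat_sum_carrier smult_carrier_mat[OF mat_sum_carrier]]
        mult_smult_distrib[OF mat_sum_carrier mat_sum_carrier])
  also have "\<dots> = E" unfolding SS E using card by (intro eq_matI) auto
  finally show EE: "E * E = E" .
  have "of_nat (vec_space.rank d E) = mat_trace E" by (rule rank_idempotent[OF Ec EE])
  also have "\<dots> = mat_trace (mat_sum d f I) / of_nat (card I)"
    unfolding E mat_trace_def by (simp add: sum_divide_distrib field_simps)
  also have "\<dots> = (\<Sum>k\<in>I. mat_trace (f k)) / of_nat (card I)"
    using f by (simp add: mat_trace_sum)
  finally show "of_nat (vec_space.rank d E) = (\<Sum>k\<in>I. mat_trace (f k)) / of_nat (card I)" .
qed

text \<open>
  The average \<open>E\<close> of the powers of \<open>A\<close> is the projection onto the vectors fixed by \<open>A\<close>, so \<open>A - Id\<close> has the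
  rank of \<open>Id - E\<close>, and the rank of \<open>E\<close> is its trace.
\<close>

lemma rank_diff_one_finite_order:
  fixes A :: "'a :: field_char_0 mat"
  assumes A: "A \<in> carrier_mat d d" and N: "N > 0" and AN: "A ^\<^sub>m N = 1\<^sub>m d"
  shows "of_nat (vec_space.rank d (A - 1\<^sub>m d)) = of_nat d - (\<Sum>k<N. mat_trace (A ^\<^sub>m k)) / of_nat N"
proof -
  define S where "S = mat_sum d (\<lambda>k. A ^\<^sub>m k) {..<N}"
  define E where "E = inverse (of_nat (card {..<N})) \<cdot>\<^sub>m S"
  have S: "S \<in> carrier_mat d d" by (simp add: S_def)
  have Ak: "A ^\<^sub>m k \<in> carrier_mat d d" for k using A by simp
  have SA: "S * A = S"
  proof -
    have "S * A = mat_sum d (\<lambda>k. A ^\<^sub>m Suc k) {..<N}"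
      unfolding S_def using A by (simp add: mat_sum_mult)
    also have "\<dots> = S"
    proof (rule eq_matI)
      fix i j assume "i < dim_row S" "j < dim_col S"
      hence ij: "i < d" "j < d" by (auto simp: S_def)
      have "(\<Sum>k<Suc N. (A ^\<^sub>m k) $$ (i, j)) = (A ^\<^sub>m 0) $$ (i, j) + (\<Sum>k<N. (A ^\<^sub>m Suc k) $$ (i, j))"
        by (rule sum.lessThan_Suc_shift)
      moreover have "A ^\<^sub>m 0 = A ^\<^sub>m N" using AN A by simp
      ultimately have "(\<Sum>k<N. (A ^\<^sub>m Suc k) $$ (i, j)) = (\<Sum>k<N. (A ^\<^sub>m k) $$ (i, j))"
        by (simp del: pow_mat.simps)
      thus "mat_sum d (\<lambda>k. A ^\<^sub>m Suc k) {..<N} $$ (i, j) = S $$ (i, j)"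
        using ij by (simp add: S_def mat_sum_index del: pow_mat.simps)
    qed (auto simp: S_def)
    finally show ?thesis .
  qed
  have SAk: "S * A ^\<^sub>m k = S" for k
  proof (induction k)
    case (Suc k)
    have "S * A ^\<^sub>m Suc k = (S * A ^\<^sub>m k) * A"
      using S A Ak[of k] by (simp add: mat_algebra)
    thus ?case using Suc SA by simp
  qed (use S A in \<open>simp add: mat_algebra\<close>)
  note E_facts = average_idempotent[of "{..<N}" "\<lambda>k. A ^\<^sub>m k" d E]
  have E: "E \<in> carrier_mat d d" and EE: "E * E = E"
    and rE: "of_nat (vec_space.rank d E) = (\<Sum>k<N. mat_trace (A ^\<^sub>m k)) / of_nat N"
    using E_facts N Ak SAk unfolding E_def S_def by auto
  have EA: "E * A = E" unfolding E_def using SA S A by (simp add: mult_smult_assoc_mat)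
  have A1: "A - 1\<^sub>m d \<in> carrier_mat d d" by (simp add: minus_carrier_mat)
  have E1: "1\<^sub>m d - E \<in> carrier_mat d d" using E by (rule minus_carrier_mat)
  have "(1\<^sub>m d - E) * (A - 1\<^sub>m d) = A - E - (1\<^sub>m d - E)"
    using A E EA by (simp add: mat_algebra)
  also have "\<dots> = A - 1\<^sub>m d" using A E by (intro eq_matI) auto
  finally have "vec_space.rank d (A - 1\<^sub>m d) \<le> vec_space.rank d (1\<^sub>m d - E)"
    using rank_mult_le_left[OF E1 A1] by simp
  hence le: "vec_space.rank d (A - 1\<^sub>m d) \<le> d - vec_space.rank d E"
    by (simp add: rank_complement[OF E EE])
  obtain m B L where B: "B \<in> carrier_mat d m" and L: "L \<in> carrier_mat m d" and LB: "L * B = 1\<^sub>m m"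
    and AB: "(A - 1\<^sub>m d) * B = 0\<^sub>m d m" and m: "d \<le> m + vec_space.rank d (A - 1\<^sub>m d)"
    using common_kernel_basis[of "{()}" "\<lambda>_. A - 1\<^sub>m d" d] A1 by auto
  have "A * B = (A - 1\<^sub>m d) * B + B"
    using A B by (simp add: mat_algebra) (rule eq_matI, auto)
  hence AB: "A * B = B" unfolding AB using B by (auto intro!: eq_matI)
  have AkB: "A ^\<^sub>m k * B = B" for k
  proof (induction k)
    case (Suc k)
    thus ?case using A B Ak[of k] AB by (simp add: mat_algebra)
  qed (use B A in \<open>simp add: mat_algebra\<close>)
  have AkBL: "A ^\<^sub>m k * (B * L) = B * L" for k
  proof -
    have "A ^\<^sub>m k * (B * L) = (A ^\<^sub>m k * B) * L" using A B L Ak[of k] by (simp add: mult_mat_assoc)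
    thus ?thesis unfolding AkB .
  qed
  have "S * (B * L) = mat_sum d (\<lambda>k. A ^\<^sub>m k * (B * L)) {..<N}"
    unfolding S_def by (rule mat_sum_mult) (use A B L in auto)
  also have "\<dots> = of_nat N \<cdot>\<^sub>m (B * L)"
    unfolding AkBL using mat_sum_const[of "B * L" d "{..<N}"] B L by simp
  finally have "E * (B * L) = inverse (of_nat N) \<cdot>\<^sub>m (of_nat N \<cdot>\<^sub>m (B * L))"
    unfolding E_def using mult_smult_assoc_mat[OF S mult_carrier_mat[OF B L]] by simp
  also have "\<dots> = B * L" using N by (intro eq_matI) auto
  finally have EBL: "E * (B * L) = B * L" .
  have "B = (B * L) * B" using LB B L by (simp add: mat_algebra)
  also have "\<dots> = (E * (B * L)) * B" unfolding EBL ..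
  also have "\<dots> = E * B" using E B L LB by (simp add: mat_algebra)
  finally have "m = vec_space.rank d (E * B)" using left_invertible_rank(1)[OF B L LB] by simp
  also have "\<dots> \<le> vec_space.rank d E" by (rule rank_mult_le_left[OF E B])
  finally have "d - vec_space.rank d E \<le> vec_space.rank d (A - 1\<^sub>m d)" using m by simp
  with le have "vec_space.rank d (A - 1\<^sub>m d) = d - vec_space.rank d E" by simp
  thus ?thesis using rE rank_le_dim[OF E] by (simp add: of_nat_diff)
qed

section \<open>Representations and their characters\<close>

text \<open>
  Invertibility of the matrices comes for free from the inverse elements of the group.
\<close>

lemma representationI:
  assumes "group G" "d \<ge> 1"
    and car: "\<And>g. g \<in> carrier G \<Longrightarrow> \<psi> g \<in> carrier_mat d d"
    and one: "\<psi> \<one>\<^bsub>G\<^esub> = 1\<^sub>m d"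
    and mult: "\<And>g h. g \<in> carrier G \<Longrightarrow> h \<in> carrier G \<Longrightarrow> \<psi> (g \<otimes>\<^bsub>G\<^esub> h) = \<psi> g * \<psi> h"
  shows "representation G d \<psi>"
proof -
  interpret group G by fact
  have "invertible_mat (\<psi> g)" if g: "g \<in> carrier G" for g
  proof -
    have "\<psi> g * \<psi> (inv\<^bsub>G\<^esub> g) = 1\<^sub>m d" "\<psi> (inv\<^bsub>G\<^esub> g) * \<psi> g = 1\<^sub>m d"
      using g by (simp_all add: mult[symmetric] one)
    thus ?thesis
      using car[OF g] car[OF inv_closed[OF g]] by (auto simp: invertible_mat_def inverts_mat_def)
  qed
  thus ?thesis
    using assms by (auto simp: representation_def hom_def carrier_GL)
qed

lemma representationD:
  assumes "group G" "representation G d \<psi>"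
  shows "d \<ge> 1" "\<And>g. g \<in> carrier G \<Longrightarrow> \<psi> g \<in> carrier_mat d d" "\<psi> \<one>\<^bsub>G\<^esub> = 1\<^sub>m d"
    "\<And>g h. g \<in> carrier G \<Longrightarrow> h \<in> carrier G \<Longrightarrow> \<psi> (g \<otimes>\<^bsub>G\<^esub> h) = \<psi> g * \<psi> h"
proof -
  interpret group G by fact
  show "d \<ge> 1" and car: "\<And>g. g \<in> carrier G \<Longrightarrow> \<psi> g \<in> carrier_mat d d"
    and mult: "\<And>g h. g \<in> carrier G \<Longrightarrow> h \<in> carrier G \<Longrightarrow> \<psi> (g \<otimes>\<^bsub>G\<^esub> h) = \<psi> g * \<psi> h"
    using assms by (auto simp: representation_def hom_def carrier_GL)
  have "\<psi> \<one>\<^bsub>G\<^esub> \<in> carrier (GL d)"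
    using assms by (auto simp: representation_def hom_def)
  then obtain B where inv: "inverts_mat (\<psi> \<one>\<^bsub>G\<^esub>) B" "inverts_mat B (\<psi> \<one>\<^bsub>G\<^esub>)"
    by (auto simp: carrier_GL invertible_mat_def)
  have E: "\<psi> \<one>\<^bsub>G\<^esub> \<in> carrier_mat d d" by (simp add: car)
  have dB: "dim_row B = d" "dim_col B = d"
    using inv E arg_cong[of _ _ dim_col] unfolding inverts_mat_def
    by (metis carrier_matD(2) index_mult_mat(3) index_one_mat(3), 
        metis carrier_matD(1) index_mult_mat(3) index_one_mat(3))
  have "\<psi> \<one>\<^bsub>G\<^esub> = \<psi> \<one>\<^bsub>G\<^esub> * (\<psi> \<one>\<^bsub>G\<^esub> * B)"
    using inv(1) E by (simp add: inverts_mat_def)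
  also have "\<dots> = (\<psi> \<one>\<^bsub>G\<^esub> * \<psi> \<one>\<^bsub>G\<^esub>) * B"
    using E dB by (simp add: mat_algebra)
  also have "\<psi> \<one>\<^bsub>G\<^esub> * \<psi> \<one>\<^bsub>G\<^esub> = \<psi> \<one>\<^bsub>G\<^esub>"
    by (simp add: mult[symmetric])
  finally show "\<psi> \<one>\<^bsub>G\<^esub> = 1\<^sub>m d" using inv(1) E by (simp add: inverts_mat_def)
qed

text \<open>
  For a matrix of finite order this is the codimension of the space of fixed vectors.  The distance to
  the identity in the statement is this number divided by \<open>d\<close>.
\<close>

abbreviation defect :: "nat \<Rightarrow> complex mat \<Rightarrow> nat" where
  "defect d A \<equiv> vec_space.rank d (A - 1\<^sub>m d)"

text \<open>
  The numbers \<open>rank(\<psi>(g) - Id)\<close> depend only on the character of \<open>\<psi>\<close>.  This is what makes them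
  additive without a proof of complete reducibility.
\<close>

lemma defect_character:
  assumes G: "group G" and rep: "representation G d \<psi>" and g: "g \<in> carrier G"
    and N: "N > 0" "g [^]\<^bsub>G\<^esub> N = \<one>\<^bsub>G\<^esub>"
  shows "of_nat (defect d (\<psi> g)) = of_nat d - (\<Sum>k<N. mat_trace (\<psi> (g [^]\<^bsub>G\<^esub> k))) / of_nat N"
proof -
  interpret group G by fact
  note R = representationD[OF G rep]
  have pow: "\<psi> g ^\<^sub>m k = \<psi> (g [^]\<^bsub>G\<^esub> k)" for k :: nat
  proof (induction k)
    case 0
    show ?case using R(2)[OF g] R(3) by simp
  next
    case (Suc k)
    thus ?case using g R(4) by (simp add: nat_pow_Suc)
  qed
  from rank_diff_one_finite_order[OF R(2)[OF g] N(1)] show ?thesis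
    using N(2) R(3) by (simp add: pow)
qed

lemma defect_additive:
  assumes G: "group G" "finite (carrier G)"
    and rep: "representation G d \<psi>" "representation G d1 \<psi>1" "representation G d2 \<psi>2"
    and tr: "\<And>g. g \<in> carrier G \<Longrightarrow> mat_trace (\<psi> g) = mat_trace (\<psi>1 g) + mat_trace (\<psi>2 g)"
    and g: "g \<in> carrier G"
  shows "defect d (\<psi> g) = defect d1 (\<psi>1 g) + defect d2 (\<psi>2 g)"
proof -
  interpret group G by fact
  have "mat_trace (1\<^sub>m d) = mat_trace (1\<^sub>m d1) + (mat_trace (1\<^sub>m d2) :: complex)"
    using tr[OF one_closed] representationD(3)[OF G(1)] rep by simp
  hence d: "of_nat d = of_nat d1 + (of_nat d2 :: complex)" by simp
  have N: "card (carrier G) > 0" "g [^]\<^bsub>G\<^esub> card (carrier G) = \<one>\<^bsub>G\<^esub>"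
    using G(2) g order_gt_0_iff_finite pow_order_eq_1[OF g] by (auto simp: Coset.order_def)
  have "(of_nat (defect d (\<psi> g)) :: complex) = of_nat (defect d1 (\<psi>1 g)) + of_nat (defect d2 (\<psi>2 g))"
    unfolding defect_character[OF G(1) rep(1) g N] defect_character[OF G(1) rep(2) g N]
      defect_character[OF G(1) rep(3) g N]
    using g by (simp add: tr d sum.distrib add_divide_distrib)
  thus ?thesis by (simp only: of_nat_add[symmetric] of_nat_eq_iff)
qed

text \<open>
  The two alternatives cover quotients and subrepresentations: either the kernel of \<open>L\<close> is
  invariant, and the compressed matrices describe the action modulo this kernel, or the image of \<open>B\<close>
  is invariant, and they describe the action on it.
\<close>

lemma representation_compress:
  assumes G: "group G" and rep: "representation G d \<psi>" and r: "r \<ge> 1"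
    and B: "B \<in> carrier_mat d r" and L: "L \<in> carrier_mat r d" and LB: "L * B = 1\<^sub>m r"
    and stable: "(\<forall>g\<in>carrier G. (L * \<psi> g) * (B * L) = L * \<psi> g) \<or>
      (\<forall>g\<in>carrier G. (B * L) * (\<psi> g * B) = \<psi> g * B)"
  shows "representation G r (\<lambda>g. L * (\<psi> g * B))"
    "g \<in> carrier G \<Longrightarrow> mat_trace (L * (\<psi> g * B)) = mat_trace ((B * L) * \<psi> g)"
proof -
  note R = representationD[OF G rep]
  note dims = carrier_matD[OF B] carrier_matD[OF L]
  show "representation G r (\<lambda>g. L * (\<psi> g * B))"
  proof (rule representationI[OF G r])
    fix g h assume g: "g \<in> carrier G" and h: "h \<in> carrier G"
    note dims' = dims carrier_matD[OF R(2)[OF g]] carrier_matD[OF R(2)[OF h]]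
    show "L * (\<psi> (g \<otimes>\<^bsub>G\<^esub> h) * B) = L * (\<psi> g * B) * (L * (\<psi> h * B))"
      using stable
    proof
      assume *: "\<forall>g\<in>carrier G. (L * \<psi> g) * (B * L) = L * \<psi> g"
      have "L * (\<psi> g * B) * (L * (\<psi> h * B)) = ((L * \<psi> g) * (B * L)) * (\<psi> h * B)"
        by (simp add: mat_algebra dims')
      also have "(L * \<psi> g) * (B * L) = L * \<psi> g" using * g by blast
      finally show ?thesis by (simp add: R(4)[OF g h] mat_algebra dims')
    next
      assume *: "\<forall>g\<in>carrier G. (B * L) * (\<psi> g * B) = \<psi> g * B"
      have "L * (\<psi> g * B) * (L * (\<psi> h * B)) = (L * \<psi> g) * ((B * L) * (\<psi> h * B))"
        by (simp add: mat_algebra dims')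
      also have "(B * L) * (\<psi> h * B) = \<psi> h * B" using * h by blast
      finally show ?thesis by (simp add: R(4)[OF g h] mat_algebra dims')
    qed
  qed (use B L R LB in \<open>auto simp: mat_algebra\<close>)
  assume g: "g \<in> carrier G"
  note dims' = dims carrier_matD[OF R(2)[OF g]]
  have "mat_trace (L * (\<psi> g * B)) = mat_trace ((\<psi> g * B) * L)"
    using B L R(2)[OF g] by (intro mat_trace_mult_comm) auto
  also have "(\<psi> g * B) * L = \<psi> g * (B * L)" by (simp add: mat_algebra dims')
  also have "mat_trace \<dots> = mat_trace ((B * L) * \<psi> g)"
    using B L R(2)[OF g] by (intro mat_trace_mult_comm) auto
  finally show "mat_trace (L * (\<psi> g * B)) = mat_trace ((B * L) * \<psi> g)" .
qed

text \<open>
  The condition on \<open>P\<close> says that the kernel of \<open>P\<close> is invariant.  Then \<open>\<psi>1\<close> is the action on the quotient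
  by this kernel and \<open>\<psi>2\<close> the action on the kernel itself, which is the image of \<open>Id - P\<close>.
\<close>

lemma representation_split:
  assumes G: "group G" and rep: "representation G d \<psi>"
    and P: "P \<in> carrier_mat d d" and PP: "P * P = P"
    and stable: "\<And>g. g \<in> carrier G \<Longrightarrow> (P * \<psi> g) * P = P * \<psi> g"
    and r: "vec_space.rank d P = r" "0 < r" "r < d"
  shows "\<exists>\<psi>1 \<psi>2. representation G r \<psi>1 \<and> representation G (d - r) \<psi>2 \<and>
    (\<forall>g\<in>carrier G. mat_trace (\<psi>1 g) = mat_trace (P * \<psi> g)) \<and>
    (\<forall>g\<in>carrier G. mat_trace (\<psi> g) = mat_trace (\<psi>1 g) + mat_trace (\<psi>2 g))"
proof -
  note R = representationD[OF G rep]
  define Q where "Q = 1\<^sub>m d - P"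
  have Q: "Q \<in> carrier_mat d d" unfolding Q_def by (rule minus_carrier_mat[OF P])
  have QQ: "Q * Q = Q" unfolding Q_def by (rule idempotent_complement[OF P PP])
  have rQ: "vec_space.rank d Q = d - r" unfolding Q_def rank_complement[OF P PP] r(1) ..
  obtain B L where B: "B \<in> carrier_mat d r" and L: "L \<in> carrier_mat r d"
    and BL: "B * L = P" and LB: "L * B = 1\<^sub>m r"
    by (rule idempotent_split[OF P PP r(1)])
  obtain B' L' where B': "B' \<in> carrier_mat d (d - r)" and L': "L' \<in> carrier_mat (d - r) d"
    and BL': "B' * L' = Q" and LB': "L' * B' = 1\<^sub>m (d - r)"
    by (rule idempotent_split[OF Q QQ rQ])
  note dims = carrier_matD[OF B] carrier_matD[OF L] carrier_matD[OF B'] carrier_matD[OF L']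
    carrier_matD[OF P] carrier_matD[OF Q]
  have LP: "L * P = L"
  proof -
    have "L * P = (L * B) * L" unfolding BL[symmetric] by (simp add: mat_algebra dims)
    thus ?thesis unfolding LB by (simp add: mat_algebra dims)
  qed
  have QB: "Q * B' = B'"
    unfolding BL'[symmetric] by (simp add: mat_algebra dims LB')
  have s1: "(L * \<psi> g) * (B * L) = L * \<psi> g" if g: "g \<in> carrier G" for g
  proof -
    note dims' = dims carrier_matD[OF R(2)[OF g]]
    have "(L * \<psi> g) * (B * L) = ((L * P) * \<psi> g) * P" unfolding BL LP ..
    also have "\<dots> = L * ((P * \<psi> g) * P)" by (simp add: mat_algebra dims')
    also have "\<dots> = (L * P) * \<psi> g" unfolding stable[OF g] by (simp add: mat_algebra dims')
    finally show ?thesis unfolding LP .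
  qed
  have s2: "(B' * L') * (\<psi> g * B') = \<psi> g * B'" if g: "g \<in> carrier G" for g
  proof -
    note dims' = dims carrier_matD[OF R(2)[OF g]]
    have PQ: "(P * \<psi> g) * Q = 0\<^sub>m d d"
      unfolding Q_def using stable[OF g] 
      by (simp add: mult_mat_diff_right mult_one_mat dims') (use P R(2)[OF g] in auto)
    have "(B' * L') * (\<psi> g * B') = Q * (\<psi> g * (Q * B'))" unfolding BL' QB ..
    also have "\<dots> = \<psi> g * (Q * B') - ((P * \<psi> g) * Q) * B'"
      by (subst (1) Q_def) (simp add: mat_algebra dims')
    also have "\<dots> = \<psi> g * B'" unfolding PQ QB by (simp add: mat_algebra dims')
    finally show ?thesis .
  qed
  have r1: "r \<ge> 1" and r2: "d - r \<ge> 1" using r by auto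
  note C1 = representation_compress[OF G rep r1 B L LB] and C2 = representation_compress[OF G rep r2 B' L' LB']
  have tr: "mat_trace (\<psi> g) = mat_trace (P * \<psi> g) + mat_trace (Q * \<psi> g)" if g: "g \<in> carrier G" for g
  proof -
    have "mat_trace (Q * \<psi> g) = mat_trace (\<psi> g) - mat_trace (P * \<psi> g)"
      unfolding Q_def using P R(2)[OF g]
      by (simp add: mult_mat_diff_left one_mult_mat) (subst mat_trace_diff[of _ d], auto)
    thus ?thesis by simp
  qed
  show ?thesis
    using C1 C2 s1 s2 tr
    by (intro exI[of _ "\<lambda>g. L * (\<psi> g * B)"] exI[of _ "\<lambda>g. L' * (\<psi> g * B')"]) (simp add: BL BL')
qed

lemma direct_sum_representation:
  assumes G: "group G" and rep: "representation G d1 \<psi>1" "representation G d2 \<psi>2"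
  shows "\<exists>\<psi>. representation G (d1 + d2) \<psi> \<and>
    (\<forall>g\<in>carrier G. mat_trace (\<psi> g) = mat_trace (\<psi>1 g) + mat_trace (\<psi>2 g))"
proof -
  note R1 = representationD[OF G rep(1)] and R2 = representationD[OF G rep(2)]
  define \<psi> where "\<psi> = (\<lambda>g. four_block_mat (\<psi>1 g) (0\<^sub>m d1 d2) (0\<^sub>m d2 d1) (\<psi>2 g))"
  have "representation G (d1 + d2) \<psi>"
  proof (rule representationI[OF G])
    show "d1 + d2 \<ge> 1" using R1(1) by simp
    show "\<psi> \<one>\<^bsub>G\<^esub> = 1\<^sub>m (d1 + d2)" by (simp add: \<psi>_def R1(3) R2(3))
    fix g h assume g: "g \<in> carrier G" and h: "h \<in> carrier G"
    show "\<psi> g \<in> carrier_mat (d1 + d2) (d1 + d2)"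
      using R1(2)[OF g] R2(2)[OF g] by (simp add: \<psi>_def)
    show "\<psi> (g \<otimes>\<^bsub>G\<^esub> h) = \<psi> g * \<psi> h"
      unfolding \<psi>_def R1(4)[OF g h] R2(4)[OF g h] using R1(2)[OF g] R2(2)[OF g] R1(2)[OF h] R2(2)[OF h]
      by (subst mult_four_block_mat[of _ d1 d1 _ d2 _ d2 _ _ d1 _ d2]) auto
  qed
  moreover have "mat_trace (\<psi> g) = mat_trace (\<psi>1 g) + mat_trace (\<psi>2 g)" if g: "g \<in> carrier G" for g
  proof -
    note c = carrier_matD[OF R1(2)[OF g]] carrier_matD[OF R2(2)[OF g]]
    have "mat_trace (\<psi> g) = (\<Sum>i<d1 + d2. \<psi> g $$ (i, i))"
      by (simp add: mat_trace_def \<psi>_def c)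
    also have "{..<d1 + d2} = {..<d1} \<union> {d1..<d1 + d2}" by auto
    also have "(\<Sum>i\<in>\<dots>. \<psi> g $$ (i, i)) = (\<Sum>i<d1. \<psi> g $$ (i, i)) + (\<Sum>i=d1..<d1 + d2. \<psi> g $$ (i, i))"
      by (rule sum.union_disjoint) auto
    also have "(\<Sum>i=d1..<d1 + d2. \<psi> g $$ (i, i)) = (\<Sum>i<d2. \<psi> g $$ (i + d1, i + d1))"
      using sum.shift_bounds_nat_ivl[of "\<lambda>i. \<psi> g $$ (i, i)" 0 d1 d2]
      by (simp add: atLeast0LessThan add.commute)
    finally show ?thesis by (simp add: mat_trace_def \<psi>_def c)
  qed
  ultimately show ?thesis by blast
qed

text \<open>
  Summing the conjugates of a rank one matrix of trace \<open>1\<close> over the group yields a matrix \<open>A\<close> that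
  commutes with \<open>\<psi>\<close>.  Its rank is at most \<open>|G| < d\<close>, and it is nonzero because its trace is \<open>|G|\<close>; hence
  its kernel is a proper nonzero invariant subspace.
\<close>

lemma representation_reduce:
  assumes G: "group G" "finite (carrier G)" and rep: "representation G d \<psi>" and d: "d > card (carrier G)"
  shows "\<exists>d1 d2 \<psi>1 \<psi>2. d = d1 + d2 \<and> representation G d1 \<psi>1 \<and> representation G d2 \<psi>2 \<and>
    (\<forall>g\<in>carrier G. mat_trace (\<psi> g) = mat_trace (\<psi>1 g) + mat_trace (\<psi>2 g))"
proof -
  interpret group G by fact
  note R = representationD[OF G(1) rep]
  \<comment> \<open>Any matrix of rank and trace \<open>1\<close> would do.\<close>
  define J :: "complex mat" where "J = mat d d (\<lambda>(i, j). if i = 0 \<and> j = 0 then 1 else 0)"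
  have J: "J \<in> carrier_mat d d" by (simp add: J_def)
  have trJ: "mat_trace J = 1"
    using R(1) by (simp add: mat_trace_def J_def)
  have rJ: "vec_space.rank d J \<le> 1"
    by (rule vec_space.rank_le_1_product_entries[of J d d "\<lambda>i. if i = 0 then 1 else 0" "\<lambda>i. if i = 0 then 1 else 0"])
       (auto simp: J_def)
  define f where "f = (\<lambda>g. \<psi> g * (J * \<psi> (inv\<^bsub>G\<^esub> g)))"
  have f: "f g \<in> carrier_mat d d" if "g \<in> carrier G" for g
    using R(2)[OF that] R(2)[OF inv_closed[OF that]] J by (simp add: f_def)
  have trf: "mat_trace (f g) = 1" if g: "g \<in> carrier G" for g
  proof -
    note c = R(2)[OF g] R(2)[OF inv_closed[OF g]]
    have "mat_trace (f g) = mat_trace ((J * \<psi> (inv\<^bsub>G\<^esub> g)) * \<psi> g)"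
      unfolding f_def using c J by (intro mat_trace_mult_comm) auto
    also have "(J * \<psi> (inv\<^bsub>G\<^esub> g)) * \<psi> g = J * (\<psi> (inv\<^bsub>G\<^esub> g) * \<psi> g)"
      using c J by (simp add: mat_algebra)
    also have "\<psi> (inv\<^bsub>G\<^esub> g) * \<psi> g = 1\<^sub>m d"
      using g by (simp add: R(4)[symmetric] R(3))
    finally show ?thesis using J trJ by simp
  qed
  define A where "A = mat_sum d f (carrier G)"
  have A: "A \<in> carrier_mat d d" by (simp add: A_def)
  obtain r where r: "vec_space.rank d A = r" by simp
  have "mat_trace A = of_nat (card (carrier G))"
    unfolding A_def using f trf by (simp add: mat_trace_sum)
  hence "A \<noteq> 0\<^sub>m d d"
    using G(2) order_gt_0_iff_finite by (auto simp: mat_trace_def Coset.order_def)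
  hence r0: "r > 0" using rank_eq_0[OF A] r by auto
  have "vec_space.rank d (f g) \<le> 1" if g: "g \<in> carrier G" for g
    using rank_mult_le_right[OF R(2)[OF g], of "J * \<psi> (inv\<^bsub>G\<^esub> g)" d]
      rank_mult_le_left[OF J R(2)[OF inv_closed[OF g]]] rJ J R(2)[OF inv_closed[OF g]]
    by (auto simp: f_def)
  hence "(\<Sum>g\<in>carrier G. vec_space.rank d (f g)) \<le> (\<Sum>g\<in>carrier G. 1)" by (rule sum_mono)
  moreover have "vec_space.rank d (mat_sum d f (carrier G)) \<le> (\<Sum>g\<in>carrier G. vec_space.rank d (f g))"
    by (rule rank_mat_sum_le[OF G(2) f])
  ultimately have "r \<le> card (carrier G)"
    unfolding r[symmetric] A_def by simp
  hence rd: "r < d" using d by simp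
  have comm: "\<psi> h * A = A * \<psi> h" if h: "h \<in> carrier G" for h
  proof -
    have "\<psi> h * A = mat_sum d (\<lambda>g. \<psi> h * f g) (carrier G)"
      unfolding A_def by (rule mult_mat_sum[OF R(2)[OF h] f])
    also have "\<dots> = mat_sum d (\<lambda>g. f (h \<otimes>\<^bsub>G\<^esub> g) * \<psi> h) (carrier G)"
    proof (rule mat_sum_cong)
      fix g assume g: "g \<in> carrier G"
      note c = R(2)[OF g] R(2)[OF inv_closed[OF g]] R(2)[OF h] R(2)[OF inv_closed[OF h]]
      have "f (h \<otimes>\<^bsub>G\<^esub> g) * \<psi> h = \<psi> h * (\<psi> g * (J * (\<psi> (inv\<^bsub>G\<^esub> g) * (\<psi> (inv\<^bsub>G\<^esub> h) * \<psi> h))))"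
        using g h c J by (simp add: f_def R(4) inv_mult_group mat_algebra)
      also have "\<psi> (inv\<^bsub>G\<^esub> h) * \<psi> h = 1\<^sub>m d" using h by (simp add: R(4)[symmetric] R(3))
      finally show "\<psi> h * f g = f (h \<otimes>\<^bsub>G\<^esub> g) * \<psi> h"
        using c J by (simp add: f_def mat_algebra)
    qed
    also have "\<dots> = mat_sum d (\<lambda>g. f g * \<psi> h) (carrier G)"
    proof (rule mat_sum_reindex)
      show "bij_betw (\<lambda>g. h \<otimes>\<^bsub>G\<^esub> g) (carrier G) (carrier G)"
        using h by (intro bij_betwI[of _ _ _ "\<lambda>g. inv\<^bsub>G\<^esub> h \<otimes>\<^bsub>G\<^esub> g"]) (auto simp: m_assoc[symmetric])
    qed
    also have "\<dots> = A * \<psi> h"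
      unfolding A_def by (rule mat_sum_mult[OF R(2)[OF h] f, symmetric])
    finally show ?thesis .
  qed
  obtain X Y X' Y' where X: "X \<in> carrier_mat d r" and Y: "Y \<in> carrier_mat r d"
    and X': "X' \<in> carrier_mat r d" and Y': "Y' \<in> carrier_mat d r"
    and XY: "A = X * Y" and XX: "X' * X = 1\<^sub>m r" and YY: "Y * Y' = 1\<^sub>m r"
    by (rule obtain_full_rank_factors[OF A r])
  note dims = carrier_matD[OF X] carrier_matD[OF Y] carrier_matD[OF X'] carrier_matD[OF Y']
  \<comment> \<open>\<open>P\<close> has the same kernel as \<open>A\<close>.\<close>
  define P where "P = Y' * Y"
  have P: "P \<in> carrier_mat d d" using Y Y' by (simp add: P_def)
  have YP: "Y * P = Y"
  proof -
    have "Y * P = (Y * Y') * Y" by (simp add: P_def mat_algebra dims)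
    thus ?thesis unfolding YY by (simp add: mat_algebra dims)
  qed
  have PP: "P * P = P" using YP by (simp add: P_def mat_algebra dims)
  have "of_nat (vec_space.rank d P) = mat_trace (Y' * Y)"
    using rank_idempotent[OF P PP] by (simp add: P_def)
  also have "\<dots> = of_nat r" using mat_trace_mult_comm[OF Y' Y] by (simp add: YY)
  finally have rP: "vec_space.rank d P = r" by (simp only: of_nat_eq_iff)
  have stable: "(P * \<psi> g) * P = P * \<psi> g" if g: "g \<in> carrier G" for g
  proof -
    note dims' = dims carrier_matD[OF R(2)[OF g]] carrier_matD[OF P]
    have "Y * \<psi> g = (X' * X) * (Y * \<psi> g)" unfolding XX by (simp add: mat_algebra dims')
    also have "\<dots> = X' * ((X * Y) * \<psi> g)" by (simp add: mat_algebra dims')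
    also have "(X * Y) * \<psi> g = \<psi> g * (X * Y)" using comm[OF g] unfolding XY by simp
    finally have *: "Y * \<psi> g = X' * (\<psi> g * (X * Y))" .
    have "(Y * \<psi> g) * P = X' * (\<psi> g * (X * (Y * P)))" unfolding * by (simp add: mat_algebra dims')
    also have "\<dots> = Y * \<psi> g" unfolding YP * ..
    finally have **: "(Y * \<psi> g) * P = Y * \<psi> g" .
    have "(P * \<psi> g) * P = Y' * ((Y * \<psi> g) * P)" by (simp add: P_def mat_algebra dims')
    also have "\<dots> = P * \<psi> g" unfolding ** by (simp add: P_def mat_algebra dims')
    finally show ?thesis .
  qed
  from representation_split[OF G(1) rep P PP stable rP r0 rd] show ?thesis
    using rd by (metis le_add_diff_inverse less_imp_le)
qed

text \<open>
  Permutation matrices of left multiplication, along an enumeration \<open>e\<close> of the group.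
\<close>

lemma regular_representation:
  assumes G: "group G" "finite (carrier G)"
  shows "\<exists>\<psi>. representation G (card (carrier G)) \<psi> \<and>
    (\<forall>g\<in>carrier G. mat_trace (\<psi> g) = (if g = \<one>\<^bsub>G\<^esub> then of_nat (card (carrier G)) else 0))"
proof -
  interpret group G by fact
  define N where "N = card (carrier G)"
  obtain e where e: "bij_betw e {..<N} (carrier G)"
    using ex_bij_betw_nat_finite[OF G(2)] unfolding N_def atLeast0LessThan by blast
  have ec: "e i \<in> carrier G" if "i < N" for i using e that by (auto simp: bij_betw_def)
  have inj: "e i = e j \<longleftrightarrow> i = j" if "i < N" "j < N" for i j
    using e that by (auto simp: bij_betw_def inj_on_def)
  define \<psi> :: "'a \<Rightarrow> complex mat" where
    "\<psi> = (\<lambda>g. mat N N (\<lambda>(i, j). if e i = g \<otimes>\<^bsub>G\<^esub> e j then 1 else 0))"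
  have "representation G N \<psi>"
  proof (rule representationI[OF G(1)])
    show "N \<ge> 1" using G(2) by (simp add: N_def Suc_le_eq card_gt_0_iff) (use one_closed in blast)
    show "\<psi> \<one>\<^bsub>G\<^esub> = 1\<^sub>m N" by (rule eq_matI) (auto simp: \<psi>_def ec inj)
    show "\<psi> g \<in> carrier_mat N N" for g by (simp add: \<psi>_def)
    fix g h assume g: "g \<in> carrier G" and h: "h \<in> carrier G"
    show "\<psi> (g \<otimes>\<^bsub>G\<^esub> h) = \<psi> g * \<psi> h"
    proof (rule eq_matI)
      fix i j assume "i < dim_row (\<psi> g * \<psi> h)" "j < dim_col (\<psi> g * \<psi> h)"
      hence i: "i < N" and j: "j < N" by (auto simp: \<psi>_def)
      have "(\<psi> g * \<psi> h) $$ (i, j) =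
          (\<Sum>k<N. (if e i = g \<otimes>\<^bsub>G\<^esub> e k then 1 else 0) * (if e k = h \<otimes>\<^bsub>G\<^esub> e j then 1 else 0))"
        using i j by (simp add: \<psi>_def scalar_prod_def atLeast0LessThan)
      also have "\<dots> = (\<Sum>x\<in>carrier G. (if e i = g \<otimes>\<^bsub>G\<^esub> x then 1 else 0) * (if x = h \<otimes>\<^bsub>G\<^esub> e j then 1 else 0))"
        by (rule sum.reindex_bij_betw[OF e])
      also have "\<dots> = (\<Sum>x\<in>carrier G. if x = h \<otimes>\<^bsub>G\<^esub> e j then (if e i = g \<otimes>\<^bsub>G\<^esub> x then 1 else 0) else 0)"
        by (rule sum.cong) auto
      also have "\<dots> = (if e i = g \<otimes>\<^bsub>G\<^esub> (h \<otimes>\<^bsub>G\<^esub> e j) then 1 else 0)"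
        using G(2) h ec[OF j] by simp
      finally show "\<psi> (g \<otimes>\<^bsub>G\<^esub> h) $$ (i, j) = (\<psi> g * \<psi> h) $$ (i, j)"
        using i j g h ec[OF j] by (simp add: \<psi>_def m_assoc)
    qed (auto simp: \<psi>_def)
  qed
  moreover have "mat_trace (\<psi> g) = (if g = \<one>\<^bsub>G\<^esub> then of_nat N else 0)" if g: "g \<in> carrier G" for g
  proof -
    have fix_iff: "e i = g \<otimes>\<^bsub>G\<^esub> e i \<longleftrightarrow> g = \<one>\<^bsub>G\<^esub>" if "i < N" for i
      using r_cancel_one'[OF ec[OF that] g] by simp
    have "mat_trace (\<psi> g) = (\<Sum>i<N. if g = \<one>\<^bsub>G\<^esub> then 1 else 0)"
      unfolding mat_trace_def by (rule sum.cong) (auto simp: \<psi>_def fix_iff)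
    thus ?thesis by simp
  qed
  ultimately show ?thesis unfolding N_def by blast
qed

text \<open>
  The projection onto the invariants of the whole group.  In particular the sum of a character is
  \<open>|G|\<close> times a natural number.
\<close>

lemma average_representation:
  assumes G: "group G" "finite (carrier G)" and rep: "representation G d \<psi>"
    and E: "E = inverse (of_nat (card (carrier G))) \<cdot>\<^sub>m mat_sum d \<psi> (carrier G)"
  shows "E \<in> carrier_mat d d" "E * E = E" "\<And>g. g \<in> carrier G \<Longrightarrow> E * \<psi> g = E"
    "of_nat (vec_space.rank d E) = (\<Sum>g\<in>carrier G. mat_trace (\<psi> g)) / of_nat (card (carrier G))"
proof -
  interpret group G by fact
  note R = representationD[OF G(1) rep]
  have S: "mat_sum d \<psi> (carrier G) * \<psi> h = mat_sum d \<psi> (carrier G)" if h: "h \<in> carrier G" for h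
  proof -
    have "mat_sum d \<psi> (carrier G) * \<psi> h = mat_sum d (\<lambda>g. \<psi> g * \<psi> h) (carrier G)"
      by (rule mat_sum_mult[OF R(2)[OF h] R(2)])
    also have "\<dots> = mat_sum d (\<lambda>g. \<psi> (g \<otimes>\<^bsub>G\<^esub> h)) (carrier G)"
      by (rule mat_sum_cong) (simp add: R(4) h)
    also have "\<dots> = mat_sum d \<psi> (carrier G)"
    proof (rule mat_sum_reindex)
      show "bij_betw (\<lambda>g. g \<otimes>\<^bsub>G\<^esub> h) (carrier G) (carrier G)"
        using h by (intro bij_betwI[of _ _ _ "\<lambda>g. g \<otimes>\<^bsub>G\<^esub> inv\<^bsub>G\<^esub> h"]) (auto simp: m_assoc)
    qed
    finally show ?thesis .
  qed
  have ne: "carrier G \<noteq> {}" using one_closed by blast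
  show "E \<in> carrier_mat d d" "E * E = E"
    "of_nat (vec_space.rank d E) = (\<Sum>g\<in>carrier G. mat_trace (\<psi> g)) / of_nat (card (carrier G))"
    using average_idempotent[OF G(2) ne R(2) S E] by auto
  show "E * \<psi> g = E" if g: "g \<in> carrier G" for g
    unfolding E by (simp add: mult_smult_assoc_mat[OF mat_sum_carrier R(2)[OF g]] S[OF g])
qed

text \<open>
  The projection onto the invariants of the regular representation has rank \<open>1\<close>, and its kernel is the
  required representation.
\<close>

lemma regular_minus_trivial_representation:
  assumes G: "group G" "finite (carrier G)" "card (carrier G) > 1"
  shows "\<exists>\<psi>. representation G (card (carrier G) - 1) \<psi> \<and>
    (\<forall>g\<in>carrier G. mat_trace (\<psi> g) = (if g = \<one>\<^bsub>G\<^esub> then of_nat (card (carrier G)) else 0) - 1)"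
proof -
  interpret group G by fact
  obtain \<rho> where rep: "representation G (card (carrier G)) \<rho>"
    and tr: "\<And>g. g \<in> carrier G \<Longrightarrow> mat_trace (\<rho> g) = (if g = \<one>\<^bsub>G\<^esub> then of_nat (card (carrier G)) else 0)"
    using regular_representation[OF G(1,2)] by blast
  define E where "E = inverse (of_nat (card (carrier G))) \<cdot>\<^sub>m mat_sum (card (carrier G)) \<rho> (carrier G)"
  note E = average_representation[OF G(1,2) rep E_def]
  have "(\<Sum>g\<in>carrier G. mat_trace (\<rho> g)) = of_nat (card (carrier G))"
    using G(2) by (simp add: tr)
  hence "of_nat (vec_space.rank (card (carrier G)) E) = (of_nat 1 :: complex)"
    using E(4) G(3) by simp
  hence r: "vec_space.rank (card (carrier G)) E = 1" by (simp only: of_nat_eq_iff)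
  have "E * \<rho> g * E = E * \<rho> g" if "g \<in> carrier G" for g
    using E(2,3) that by simp
  from representation_split[OF G(1) rep E(1,2) this r _ G(3)]
  obtain \<psi>1 \<psi> where "representation G (card (carrier G) - 1) \<psi>"
    and tr1: "\<And>g. g \<in> carrier G \<Longrightarrow> mat_trace (\<psi>1 g) = mat_trace (E * \<rho> g)"
    and tr2: "\<And>g. g \<in> carrier G \<Longrightarrow> mat_trace (\<rho> g) = mat_trace (\<psi>1 g) + mat_trace (\<psi> g)" by auto
  moreover have "mat_trace E = 1" using rank_idempotent[OF E(1,2)] r by simp
  hence "mat_trace (\<psi> g) = (if g = \<one>\<^bsub>G\<^esub> then of_nat (card (carrier G)) else 0) - 1"
    if "g \<in> carrier G" for g
    using tr2[OF that] tr1[OF that] tr[OF that] E(3)[OF that] by (simp add: algebra_simps)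
  ultimately show ?thesis by blast
qed

section \<open>Matrix games over an ordered field\<close>

text \<open>
  Constraints with \<open>a > 0\<close> bound \<open>y\<close> from below, those with \<open>a < 0\<close> from above; the pair condition says
  that every lower bound lies below every upper bound.
\<close>

lemma one_variable_feasible:
  fixes S :: "('k :: linordered_field \<times> 'k) set"
  assumes fin: "finite S"
  shows "(\<exists>y. \<forall>(a, h)\<in>S. 0 \<le> a * y + h) \<longleftrightarrow>
    (\<forall>(a, h)\<in>S. a = 0 \<longrightarrow> 0 \<le> h) \<and>
    (\<forall>(a, h)\<in>S. \<forall>(b, k)\<in>S. 0 < a \<and> b < 0 \<longrightarrow> 0 \<le> a * k - b * h)"
    (is "?feasible \<longleftrightarrow> ?zero \<and> ?pairs")
proof
  assume ?feasible
  then obtain y where y: "\<And>a h. (a, h) \<in> S \<Longrightarrow> 0 \<le> a * y + h" by blast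
  have "0 \<le> a * k - b * h" if "(a, h) \<in> S" "(b, k) \<in> S" "0 < a" "b < 0" for a h b k
  proof -
    have "0 \<le> a * (b * y + k)" "0 \<le> (- b) * (a * y + h)"
      using y[OF that(1)] y[OF that(2)] that(3,4) by (intro mult_nonneg_nonneg; simp)+
    hence "0 \<le> a * (b * y + k) + (- b) * (a * y + h)" by (rule add_nonneg_nonneg)
    thus ?thesis by (simp add: algebra_simps)
  qed
  thus "?zero \<and> ?pairs" using y by fastforce
next
  assume R: "?zero \<and> ?pairs"
  have pairs: "0 \<le> a * k - b * h" if "(a, h) \<in> S" "(b, k) \<in> S" "0 < a" "b < 0" for a h b k
    using R that by blast
  define lo where "lo = (\<lambda>p. - snd p / fst p) ` {p \<in> S. 0 < fst p}"
  define up where "up = (\<lambda>p. - snd p / fst p) ` {p \<in> S. fst p < 0}"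
  have fin': "finite lo" "finite up" using fin by (auto simp: lo_def up_def)
  consider "lo \<noteq> {}" | "lo = {}" "up \<noteq> {}" | "lo = {}" "up = {}" by blast
  thus ?feasible
  proof cases
    case 1
    with fin' have "Max lo \<in> lo" by simp
    then obtain a0 h0 where a0: "(a0, h0) \<in> S" "0 < a0" "Max lo = - h0 / a0"
      by (auto simp: lo_def)
    have "0 \<le> a * Max lo + h" if ah: "(a, h) \<in> S" for a h
    proof (cases a "0 :: 'k" rule: linorder_cases)
      case less
      have "0 \<le> a0 * h - a * h0" using pairs[OF a0(1) ah a0(2) less] .
      moreover have "h0 = - (a0 * Max lo)" using a0 by simp
      ultimately have "0 \<le> a0 * (a * Max lo + h)" by (simp add: algebra_simps)
      thus ?thesis using a0 by (simp add: zero_le_mult_iff)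
    next
      case equal
      thus ?thesis using R ah by auto
    next
      case greater
      hence "- h / a \<in> lo" using ah by (force simp: lo_def)
      hence "- h / a \<le> Max lo" using fin' by simp
      thus ?thesis using greater by (simp add: field_simps)
    qed
    thus ?thesis by blast
  next
    case 2
    have "0 \<le> a * Min up + h" if ah: "(a, h) \<in> S" for a h
    proof (cases a "0 :: 'k" rule: linorder_cases)
      case less
      hence "- h / a \<in> up" using ah by (force simp: up_def)
      hence "Min up \<le> - h / a" using fin' by simp
      thus ?thesis using less by (simp add: field_simps)
    next
      case equal
      thus ?thesis using R ah by auto
    next
      case greater
      hence "- h / a \<in> lo" using ah by (force simp: lo_def)
      thus ?thesis using 2 by simp
    qed
    thus ?thesis by blast
  next
    case 3
    have "0 \<le> a * 0 + h" if ah: "(a, h) \<in> S" for a h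
    proof -
      have "a = 0"
        using 3 ah by (cases a "0 :: 'k" rule: linorder_cases) (force simp: lo_def up_def)+
      thus ?thesis using R ah by auto
    qed
    thus ?thesis by blast
  qed
qed

text \<open>
  A constraint is a triple: coefficients of the variables \<open>x i\<close>, a coefficient of the parameter \<open>t\<close>,
  and a constant term.
\<close>

fun constraint_value ::
    "'i set \<Rightarrow> ('i \<Rightarrow> 'k :: linordered_field) \<Rightarrow> 'k \<Rightarrow> ('i \<Rightarrow> 'k) \<times> 'k \<times> 'k \<Rightarrow> 'k" where
  "constraint_value I x t (c, \<alpha>, \<beta>) = (\<Sum>i\<in>I. c i * x i) + \<alpha> * t + \<beta>"

text \<open>
  Eliminating all variables leaves finitely many affine conditions on the parameter \<open>t\<close>, with
  coefficients in the same field.  It is essential that this works over the rationals, since it makes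
  optimal values rational.
\<close>

lemma fourier_motzkin:
  fixes C :: "(('i \<Rightarrow> 'k :: linordered_field) \<times> 'k \<times> 'k) set"
  assumes "finite I" "finite C"
  shows "\<exists>D. finite D \<and>
    (\<forall>t. (\<exists>x. \<forall>q\<in>C. 0 \<le> constraint_value I x t q) \<longleftrightarrow> (\<forall>(\<alpha>, \<beta>)\<in>D. 0 \<le> \<alpha> * t + \<beta>))"
  using assms
proof (induction I arbitrary: C rule: finite_induct)
  case empty
  have "constraint_value {} x t q = fst (snd q) * t + snd (snd q)" for x t and q :: "('i \<Rightarrow> 'k) \<times> 'k \<times> 'k"
    by (cases q) simp
  thus ?case using empty by (intro exI[of _ "snd ` C"]) (simp add: split_def)
next
  case (insert j I)
  define comb :: "(('i \<Rightarrow> 'k) \<times> 'k \<times> 'k) \<times> (('i \<Rightarrow> 'k) \<times> 'k \<times> 'k) \<Rightarrow> ('i \<Rightarrow> 'k) \<times> 'k \<times> 'k"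
    where "comb = (\<lambda>((c, \<alpha>, \<beta>), (c', \<alpha>', \<beta>')).
      (\<lambda>i. c j * c' i - c' j * c i, c j * \<alpha>' - c' j * \<alpha>, c j * \<beta>' - c' j * \<beta>))"
  define C' where "C' = {q \<in> C. fst q j = 0} \<union> comb ` {(p, q) \<in> C \<times> C. 0 < fst p j \<and> fst q j < 0}"
  have "{(p, q) \<in> C \<times> C. 0 < fst p j \<and> fst q j < 0} \<subseteq> C \<times> C" by blast
  hence "finite {(p, q) \<in> C \<times> C. 0 < fst p j \<and> fst q j < 0}"
    by (rule finite_subset) (use insert.prems in simp)
  hence "finite C'" unfolding C'_def using insert.prems by (intro finite_UnI finite_imageI) auto
  from insert.IH[OF this] obtain D where D: "finite D"
    "\<And>t. (\<exists>x. \<forall>q\<in>C'. 0 \<le> constraint_value I x t q) \<longleftrightarrow> (\<forall>(\<alpha>, \<beta>)\<in>D. 0 \<le> \<alpha> * t + \<beta>)"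
    by blast
  have comb: "constraint_value I x t (comb (p, q)) =
      fst p j * constraint_value I x t q - fst q j * constraint_value I x t p" for x t p q
    by (cases p; cases q) (simp add: comb_def algebra_simps sum_subtractf sum_distrib_left)
  have step: "(\<exists>y. \<forall>q\<in>C. 0 \<le> constraint_value (insert j I) (x(j := y)) t q) \<longleftrightarrow>
      (\<forall>q\<in>C'. 0 \<le> constraint_value I x t q)" for x t
  proof -
    define S where "S = (\<lambda>q. (fst q j, constraint_value I x t q)) ` C"
    have val: "constraint_value (insert j I) (x(j := y)) t q = fst q j * y + constraint_value I x t q" for y q
    proof -
      have "(\<Sum>i\<in>I. c i * (x(j := y)) i) = (\<Sum>i\<in>I. c i * x i)" for c :: "'i \<Rightarrow> 'k"
        using insert.hyps by (intro sum.cong) auto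
      thus ?thesis using insert.hyps by (cases q) simp
    qed
    have "(\<exists>y. \<forall>q\<in>C. 0 \<le> constraint_value (insert j I) (x(j := y)) t q) \<longleftrightarrow>
        (\<exists>y. \<forall>(a, h)\<in>S. 0 \<le> a * y + h)"
      unfolding val S_def by simp
    also have "\<dots> \<longleftrightarrow> (\<forall>(a, h)\<in>S. a = 0 \<longrightarrow> 0 \<le> h) \<and>
        (\<forall>(a, h)\<in>S. \<forall>(b, k)\<in>S. 0 < a \<and> b < 0 \<longrightarrow> 0 \<le> a * k - b * h)"
      using insert.prems by (intro one_variable_feasible) (simp add: S_def)
    also have "\<dots> \<longleftrightarrow> (\<forall>q\<in>C. fst q j = 0 \<longrightarrow> 0 \<le> constraint_value I x t q) \<and>
        (\<forall>p\<in>C. \<forall>q\<in>C. 0 < fst p j \<and> fst q j < 0 \<longrightarrow> 0 \<le> constraint_value I x t (comb (p, q)))"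
      unfolding S_def comb by simp
    also have "\<dots> \<longleftrightarrow> (\<forall>q\<in>C'. 0 \<le> constraint_value I x t q)"
      unfolding C'_def by blast
    finally show ?thesis .
  qed
  have "(\<exists>x. \<forall>q\<in>C. 0 \<le> constraint_value (insert j I) x t q) \<longleftrightarrow>
      (\<exists>x y. \<forall>q\<in>C. 0 \<le> constraint_value (insert j I) (x(j := y)) t q)" for t
    by (metis fun_upd_triv)
  thus ?case using D step by (intro exI[of _ D]) simp
qed

text \<open>
  Boundedness forces a constraint with negative slope, and the maximum is the least root among
  those.
\<close>

lemma affine_constraints_attain_max:
  fixes D :: "('k :: linordered_field \<times> 'k) set"
  assumes "finite D"
    and t0: "\<forall>(\<alpha>, \<beta>)\<in>D. 0 \<le> \<alpha> * t0 + \<beta>"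
    and bound: "\<And>t. \<forall>(\<alpha>, \<beta>)\<in>D. 0 \<le> \<alpha> * t + \<beta> \<Longrightarrow> t \<le> K"
  shows "\<exists>t. (\<forall>(\<alpha>, \<beta>)\<in>D. 0 \<le> \<alpha> * t + \<beta>) \<and> (\<forall>s. (\<forall>(\<alpha>, \<beta>)\<in>D. 0 \<le> \<alpha> * s + \<beta>) \<longrightarrow> s \<le> t)"
proof -
  define R where "R = (\<lambda>p. - snd p / fst p) ` {p \<in> D. fst p < 0}"
  have finR: "finite R" using assms(1) by (simp add: R_def)
  have below: "s \<le> q" if "\<forall>(\<alpha>, \<beta>)\<in>D. 0 \<le> \<alpha> * s + \<beta>" "q \<in> R" for s q
    using that by (fastforce simp: R_def field_simps)
  have "R \<noteq> {}"
  proof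
    assume R: "R = {}"
    have "\<forall>(\<alpha>, \<beta>)\<in>D. 0 \<le> \<alpha> * (max t0 (K + 1)) + \<beta>"
    proof safe
      fix \<alpha> \<beta> assume D: "(\<alpha>, \<beta>) \<in> D"
      hence "0 \<le> \<alpha>" using R by (force simp: R_def)
      hence "\<alpha> * t0 \<le> \<alpha> * max t0 (K + 1)" by (intro mult_left_mono) auto
      thus "0 \<le> \<alpha> * max t0 (K + 1) + \<beta>" using t0 D by fastforce
    qed
    from bound[OF this] show False by simp
  qed
  show ?thesis
  proof (intro exI[of _ "Min R"] conjI allI impI)
    show "s \<le> Min R" if "\<forall>(\<alpha>, \<beta>)\<in>D. 0 \<le> \<alpha> * s + \<beta>" for s
      using below[OF that] finR \<open>R \<noteq> {}\<close> by simp
    show "\<forall>(\<alpha>, \<beta>)\<in>D. 0 \<le> \<alpha> * Min R + \<beta>"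
    proof safe
      fix \<alpha> \<beta> assume D: "(\<alpha>, \<beta>) \<in> D"
      show "0 \<le> \<alpha> * Min R + \<beta>"
      proof (cases "\<alpha> < 0")
        case True
        hence "- \<beta> / \<alpha> \<in> R" using D by (force simp: R_def)
        hence "Min R \<le> - \<beta> / \<alpha>" using finR by simp
        thus ?thesis using True by (simp add: field_simps)
      next
        case False
        have "t0 \<le> Min R" using below[OF t0] finR \<open>R \<noteq> {}\<close> by simp
        hence "\<alpha> * t0 \<le> \<alpha> * Min R" using False by (intro mult_left_mono) auto
        thus ?thesis using t0 D by fastforce
      qed
    qed
  qed
qed

lemma clear_denominators:
  fixes x :: "'i \<Rightarrow> rat"
  assumes "finite I" "\<And>i. i \<in> I \<Longrightarrow> 0 \<le> x i"
  shows "\<exists>m w. m > 0 \<and> (\<forall>i\<in>I. of_nat m * x i = of_nat (w i))"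
  using assms
proof (induction I rule: finite_induct)
  case empty
  show ?case by (auto intro: exI[of _ 1])
next
  case (insert j I)
  then obtain m w where m: "m > 0" "\<And>i. i \<in> I \<Longrightarrow> of_nat m * x i = of_nat (w i)" by auto
  obtain a b where ab: "x j = of_int a / of_int b" "b > 0"
    by (metis quotient_of_denom_pos quotient_of_div surj_pair)
  hence "0 \<le> a" using insert.prems[of j] by (simp add: zero_le_divide_iff)
  have "of_nat (m * nat b) * x i = of_nat ((w(j := m * nat a)) i * (if i = j then 1 else nat b))"
    if "i \<in> insert j I" for i
    using that insert.hyps m(2)[of i] ab \<open>0 \<le> a\<close>
    by (auto simp: field_simps)
  moreover have "m * nat b > 0" using m ab by simp
  ultimately show ?case
    by (intro exI[of _ "m * nat b"] exI[of _ "\<lambda>i. (w(j := m * nat a)) i * (if i = j then 1 else nat b)"])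
       blast
qed

text \<open>
  The optimal value \<open>t\<close> of a ratio game: the row player chooses weights \<open>w\<close>, the column player an index
  \<open>j\<close>, and the payoff is \<open>(\<Sum>i. w i * a i j) / (\<Sum>i. w i * d i)\<close>.  After normalizing the denominator to \<open>1\<close>, the
  values that the row player can guarantee are the feasible parameters of a linear system.
\<close>

lemma optimal_weights_exist:
  fixes d :: "'i \<Rightarrow> nat" and a :: "'i \<Rightarrow> 'j \<Rightarrow> nat"
  assumes I: "finite I" "I \<noteq> {}" and J: "finite J" "J \<noteq> {}" and d_ge_1: "\<forall>i\<in>I. d i \<ge> 1"
  shows "\<exists>w (t :: rat). (\<exists>i\<in>I. 0 < w i) \<and>
    (\<forall>j\<in>J. t * of_nat (\<Sum>i\<in>I. w i * d i) \<le> of_nat (\<Sum>i\<in>I. w i * a i j)) \<and>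
    (\<forall>w'. (\<exists>i\<in>I. 0 < w' i) \<longrightarrow>
      (\<exists>j\<in>J. of_nat (\<Sum>i\<in>I. w' i * a i j) \<le> t * of_nat (\<Sum>i\<in>I. w' i * d i)))"
proof -
  note d = bspec[OF d_ge_1]
  define feas where "feas = (\<lambda>(t :: rat) x. (\<forall>i\<in>I. 0 \<le> x i) \<and> (\<Sum>i\<in>I. of_nat (d i) * x i) = 1 \<and>
    (\<forall>j\<in>J. t \<le> (\<Sum>i\<in>I. of_nat (a i j) * x i)))"
  define C :: "(('i \<Rightarrow> rat) \<times> rat \<times> rat) set" where
    "C = (\<lambda>i. (\<lambda>k. if k = i then 1 else 0, 0, 0)) ` I \<union>
      {(\<lambda>i. of_nat (d i), 0, - 1), (\<lambda>i. - of_nat (d i), 0, 1)} \<union>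
      (\<lambda>j. (\<lambda>i. of_nat (a i j), - 1, 0)) ` J"
  have "finite C" using I J by (simp add: C_def)
  have unit: "(\<Sum>k\<in>I. (if k = i then 1 else 0) * x k) = x i" if "i \<in> I" for i and x :: "'i \<Rightarrow> rat"
  proof -
    have "(\<Sum>k\<in>I. (if k = i then 1 else 0) * x k) = (\<Sum>k\<in>I. if k = i then x k else 0)"
      by (rule sum.cong) auto
    thus ?thesis using I that by simp
  qed
  have C_iff: "(\<forall>q\<in>C. 0 \<le> constraint_value I x t q) \<longleftrightarrow> feas t x" for x t
    unfolding C_def feas_def
    by (auto simp: ball_Un unit sum_negf)
  obtain D where D: "finite D" "\<And>t. (\<exists>x. feas t x) \<longleftrightarrow> (\<forall>(\<alpha>, \<beta>)\<in>D. 0 \<le> \<alpha> * t + \<beta>)"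
    using fourier_motzkin[OF I(1) \<open>finite C\<close>] unfolding C_iff by blast
  obtain i0 j0 where i0: "i0 \<in> I" and j0: "j0 \<in> J" using I J by blast
  \<comment> \<open>The parameter \<open>0\<close> is feasible: put all weight on one index.\<close>
  define x0 :: "'i \<Rightarrow> rat" where "x0 = (\<lambda>i. if i = i0 then 1 / of_nat (d i0) else 0)"
  have "(\<Sum>i\<in>I. of_nat (d i) * x0 i) = (\<Sum>i\<in>I. if i = i0 then 1 else 0)"
    using d by (intro sum.cong) (auto simp: x0_def dest: d)
  hence "feas 0 x0" using I i0 by (auto simp: feas_def x0_def intro!: sum_nonneg)
  hence zero: "\<forall>(\<alpha>, \<beta>)\<in>D. 0 \<le> \<alpha> * 0 + \<beta>" using D(2)[of 0] by blast
  have bound: "t \<le> (\<Sum>i\<in>I. of_nat (a i j0))" if "\<forall>(\<alpha>, \<beta>)\<in>D. 0 \<le> \<alpha> * t + \<beta>" for t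
  proof -
    from that have "\<exists>x. feas t x" by (simp only: D(2))
    then obtain x where x: "feas t x" ..
    have x1: "x i \<le> 1" if i: "i \<in> I" for i
    proof -
      have "1 * x i \<le> of_nat (d i) * x i"
        using d[OF i] x i by (intro mult_right_mono) (auto simp: feas_def)
      hence "x i \<le> of_nat (d i) * x i" by simp
      also have "\<dots> \<le> (\<Sum>i\<in>I. of_nat (d i) * x i)"
        using x i I(1) by (intro member_le_sum) (auto simp: feas_def)
      also have "\<dots> = 1" using x by (simp add: feas_def)
      finally show ?thesis .
    qed
    have "t \<le> (\<Sum>i\<in>I. of_nat (a i j0) * x i)" using x j0 by (simp add: feas_def)
    also have "\<dots> \<le> (\<Sum>i\<in>I. of_nat (a i j0))"
      using x1 by (intro sum_mono mult_left_le) auto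
    finally show ?thesis .
  qed
  obtain t where t: "\<forall>(\<alpha>, \<beta>)\<in>D. 0 \<le> \<alpha> * t + \<beta>"
    "\<And>s. \<forall>(\<alpha>, \<beta>)\<in>D. 0 \<le> \<alpha> * s + \<beta> \<Longrightarrow> s \<le> t"
    using affine_constraints_attain_max[OF D(1) zero bound] by blast
  from t(1) have "\<exists>x. feas t x" by (simp only: D(2))
  then obtain x where x: "feas t x" ..
  obtain m w where m: "m > 0" and w: "\<And>i. i \<in> I \<Longrightarrow> of_nat m * x i = of_nat (w i)"
    using clear_denominators[OF I(1), of x] x by (auto simp: feas_def)
  have lin: "of_nat (\<Sum>i\<in>I. w i * c i) = of_nat m * (\<Sum>i\<in>I. of_nat (c i) * x i)" for c
    using w by (auto simp: sum_distrib_left mult_ac intro!: sum.cong)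
  have wd: "of_nat (\<Sum>i\<in>I. w i * d i) = (of_nat m :: rat)"
    unfolding lin using x by (simp add: feas_def)
  show ?thesis
  proof (intro exI[of _ w] exI[of _ t] conjI ballI allI impI)
    show "\<exists>i\<in>I. 0 < w i"
    proof (rule ccontr)
      assume "\<not> (\<exists>i\<in>I. 0 < w i)"
      hence "(\<Sum>i\<in>I. w i * d i) = 0" by simp
      thus False using wd m by simp
    qed
    show "t * of_nat (\<Sum>i\<in>I. w i * d i) \<le> of_nat (\<Sum>i\<in>I. w i * a i j)" if "j \<in> J" for j
      unfolding wd unfolding lin using x that m by (simp add: feas_def mult.commute)
    show "\<exists>j\<in>J. of_nat (\<Sum>i\<in>I. w' i * a i j) \<le> t * of_nat (\<Sum>i\<in>I. w' i * d i)"
      if w': "\<exists>i\<in>I. 0 < w' i" for w'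
    proof (rule ccontr)
      assume "\<not> ?thesis"
      hence less: "t * of_nat (\<Sum>i\<in>I. w' i * d i) < of_nat (\<Sum>i\<in>I. w' i * a i j)" if "j \<in> J" for j
        using that by force
      define n where "n = (\<Sum>i\<in>I. w' i * d i)"
      obtain i where i: "i \<in> I" "0 < w' i" using w' by blast
      have "w' i * d i \<le> n" unfolding n_def using i I(1) by (intro member_le_sum) auto
      hence "n > 0" using i d[OF i(1)] by (metis less_le_trans mult_pos_pos not_one_le_zero not_gr_zero)
      define s where "s = Min ((\<lambda>j. of_nat (\<Sum>i\<in>I. w' i * a i j) / of_nat n :: rat) ` J)"
      have "t < s"
        unfolding s_def
      proof (subst Min_gr_iff, safe)
        fix j assume "j \<in> J"
        from less[OF this] \<open>n > 0\<close> show "t < of_nat (\<Sum>i\<in>I. w' i * a i j) / of_nat n"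
          unfolding n_def[symmetric] by (simp only: pos_less_divide_eq of_nat_0_less_iff)
      qed (use J in auto)
      have "feas s (\<lambda>i. of_nat (w' i) / of_nat n)"
        unfolding feas_def
      proof (intro conjI ballI)
        have "(\<Sum>i\<in>I. of_nat (d i) * (of_nat (w' i) / of_nat n)) = of_nat (\<Sum>i\<in>I. w' i * d i) / (of_nat n :: rat)"
          by (simp add: sum_divide_distrib mult.commute)
        thus "(\<Sum>i\<in>I. of_nat (d i) * (of_nat (w' i) / of_nat n)) = (1 :: rat)"
          using \<open>n > 0\<close> unfolding n_def[symmetric] by simp
        fix j assume j: "j \<in> J"
        have "s \<le> of_nat (\<Sum>i\<in>I. w' i * a i j) / of_nat n"
          unfolding s_def using J j by (intro Min_le) auto
        thus "s \<le> (\<Sum>i\<in>I. of_nat (a i j) * (of_nat (w' i) / of_nat n))"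
          by (simp add: sum_divide_distrib mult.commute)
      qed auto
      hence "\<exists>x. feas s x" by (rule exI[of "feas s"])
      hence "s \<le> t" by (intro t(2)) (simp only: D(2))
      with \<open>t < s\<close> show False by simp
    qed
  qed
qed

section \<open>An optimal representation\<close>

text \<open>
  The rank data of a representation, recorded together with its dimension; restriction to
  the elements other than the identity makes the function extensional, so that there are only finitely
  many data of bounded dimension.
\<close>

definition small_types :: "('a, 'b) monoid_scheme \<Rightarrow> (nat \<times> ('a \<Rightarrow> nat)) set" where
  "small_types G = {(d, \<lambda>g\<in>carrier G - {\<one>\<^bsub>G\<^esub>}. defect d (\<psi> g)) | d \<psi>.
    representation G d \<psi> \<and> d \<le> card (carrier G)}"

lemma finite_small_types:
  assumes G: "group G" "finite (carrier G)"
  shows "finite (small_types G)"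
proof (rule finite_subset)
  show "small_types G \<subseteq> {..card (carrier G)} \<times> (carrier G - {\<one>\<^bsub>G\<^esub>} \<rightarrow>\<^sub>E {..card (carrier G)})"
  proof
    fix \<tau> assume "\<tau> \<in> small_types G"
    then obtain d \<psi> where rep: "representation G d \<psi>" and d: "d \<le> card (carrier G)"
      and \<tau>: "\<tau> = (d, \<lambda>g\<in>carrier G - {\<one>\<^bsub>G\<^esub>}. defect d (\<psi> g))"
      by (auto simp: small_types_def)
    have "defect d (\<psi> g) \<le> card (carrier G)" if "g \<in> carrier G" for g
    proof -
      have "\<psi> g - 1\<^sub>m d \<in> carrier_mat d d" by (rule minus_carrier_mat) simp
      from rank_le_dim[OF this] d show ?thesis by simp
    qed
    thus "\<tau> \<in> {..card (carrier G)} \<times> (carrier G - {\<one>\<^bsub>G\<^esub>} \<rightarrow>\<^sub>E {..card (carrier G)})"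
      using d by (auto simp: \<tau>)
  qed
  show "finite ({..card (carrier G)} \<times> (carrier G - {\<one>\<^bsub>G\<^esub>} \<rightarrow>\<^sub>E {..card (carrier G)}))"
    using G(2) by (intro finite_cartesian_product finite_PiE) auto
qed

text \<open>
  Representations of dimension above \<open>|G|\<close> are cut into two smaller ones until only small ones remain.
\<close>

lemma representation_weights:
  assumes G: "group G" "finite (carrier G)" and rep: "representation G d \<psi>"
  shows "\<exists>w. d = (\<Sum>\<tau>\<in>small_types G. w \<tau> * fst \<tau>) \<and>
    (\<forall>g\<in>carrier G - {\<one>\<^bsub>G\<^esub>}. defect d (\<psi> g) = (\<Sum>\<tau>\<in>small_types G. w \<tau> * snd \<tau> g))"
  using rep
proof (induction d arbitrary: \<psi> rule: less_induct)
  case (less d)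
  note fin = finite_small_types[OF G]
  show ?case
  proof (cases "d \<le> card (carrier G)")
    case True
    define \<tau> where "\<tau> = (d, \<lambda>g\<in>carrier G - {\<one>\<^bsub>G\<^esub>}. defect d (\<psi> g))"
    have \<tau>: "\<tau> \<in> small_types G" using True less.prems by (auto simp: small_types_def \<tau>_def)
    have pick: "(\<Sum>\<sigma>\<in>small_types G. (if \<sigma> = \<tau> then 1 else 0) * c \<sigma>) = c \<tau>" for c :: "_ \<Rightarrow> nat"
    proof -
      have "(\<Sum>\<sigma>\<in>small_types G. (if \<sigma> = \<tau> then 1 else 0) * c \<sigma>) = (\<Sum>\<sigma>\<in>small_types G. if \<sigma> = \<tau> then c \<sigma> else 0)"
        by (rule sum.cong) auto
      thus ?thesis using \<tau> fin by simp
    qed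
    show ?thesis
      by (intro exI[of _ "\<lambda>\<sigma>. if \<sigma> = \<tau> then 1 else 0"], unfold pick) (simp add: \<tau>_def)
  next
    case False
    then obtain d1 d2 \<psi>1 \<psi>2 where d: "d = d1 + d2"
      and rep: "representation G d1 \<psi>1" "representation G d2 \<psi>2"
      and tr: "\<And>g. g \<in> carrier G \<Longrightarrow> mat_trace (\<psi> g) = mat_trace (\<psi>1 g) + mat_trace (\<psi>2 g)"
      using representation_reduce[OF G less.prems] by auto
    have "d1 < d" "d2 < d" using d representationD(1)[OF G(1)] rep by fastforce+
    obtain w1 where w1: "d1 = (\<Sum>\<tau>\<in>small_types G. w1 \<tau> * fst \<tau>)"
      "\<And>g. g \<in> carrier G - {\<one>\<^bsub>G\<^esub>} \<Longrightarrow> defect d1 (\<psi>1 g) = (\<Sum>\<tau>\<in>small_types G. w1 \<tau> * snd \<tau> g)"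
      using less.IH[OF \<open>d1 < d\<close> rep(1)] by blast
    obtain w2 where w2: "d2 = (\<Sum>\<tau>\<in>small_types G. w2 \<tau> * fst \<tau>)"
      "\<And>g. g \<in> carrier G - {\<one>\<^bsub>G\<^esub>} \<Longrightarrow> defect d2 (\<psi>2 g) = (\<Sum>\<tau>\<in>small_types G. w2 \<tau> * snd \<tau> g)"
      using less.IH[OF \<open>d2 < d\<close> rep(2)] by blast
    have "d = (\<Sum>\<tau>\<in>small_types G. (w1 \<tau> + w2 \<tau>) * fst \<tau>)"
      unfolding add_mult_distrib sum.distrib using d w1(1) w2(1) by simp
    moreover have "defect d (\<psi> g) = (\<Sum>\<tau>\<in>small_types G. (w1 \<tau> + w2 \<tau>) * snd \<tau> g)"
      if "g \<in> carrier G - {\<one>\<^bsub>G\<^esub>}" for g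
      unfolding add_mult_distrib sum.distrib
      using defect_additive[OF G less.prems rep tr, of g] w1(2)[OF that] w2(2)[OF that] that by simp
    ultimately show ?thesis by (intro exI[of _ "\<lambda>\<tau>. w1 \<tau> + w2 \<tau>"]) blast
  qed
qed

text \<open>
  The converse: realize the combination by a direct sum, adding one summand at a time.
\<close>

lemma representation_of_weights:
  assumes G: "group G" "finite (carrier G)" and w: "\<exists>\<tau>\<in>small_types G. 0 < w \<tau>"
  shows "\<exists>d \<psi>. representation G d \<psi> \<and> d = (\<Sum>\<tau>\<in>small_types G. w \<tau> * fst \<tau>) \<and>
    (\<forall>g\<in>carrier G - {\<one>\<^bsub>G\<^esub>}. defect d (\<psi> g) = (\<Sum>\<tau>\<in>small_types G. w \<tau> * snd \<tau> g))"
  using w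
proof (induction "\<Sum>\<tau>\<in>small_types G. w \<tau>" arbitrary: w rule: less_induct)
  case (less w)
  note fin = finite_small_types[OF G]
  from less.prems obtain \<tau> where \<tau>: "\<tau> \<in> small_types G" "0 < w \<tau>" by blast
  define w' where "w' = w(\<tau> := w \<tau> - 1)"
  have split: "(\<Sum>\<sigma>\<in>small_types G. w \<sigma> * c \<sigma>) = (\<Sum>\<sigma>\<in>small_types G. w' \<sigma> * c \<sigma>) + c \<tau>"
    for c :: "_ \<Rightarrow> nat"
  proof -
    have "(\<Sum>\<sigma>\<in>small_types G - {\<tau>}. w \<sigma> * c \<sigma>) = (\<Sum>\<sigma>\<in>small_types G - {\<tau>}. w' \<sigma> * c \<sigma>)"
      by (rule sum.cong) (auto simp: w'_def)
    moreover have "w \<tau> * c \<tau> = w' \<tau> * c \<tau> + c \<tau>"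
      using \<tau>(2) by (cases "w \<tau>") (auto simp: w'_def)
    ultimately show ?thesis by (simp add: sum.remove[OF fin \<tau>(1)])
  qed
  from \<tau>(1) obtain d \<psi> where rep: "representation G d \<psi>"
    and \<tau>_eq: "\<tau> = (d, \<lambda>g\<in>carrier G - {\<one>\<^bsub>G\<^esub>}. defect d (\<psi> g))"
    by (auto simp: small_types_def)
  show ?case
  proof (cases "\<exists>\<sigma>\<in>small_types G. 0 < w' \<sigma>")
    case True
    have "(\<Sum>\<sigma>\<in>small_types G. w' \<sigma>) < (\<Sum>\<sigma>\<in>small_types G. w \<sigma>)"
      using split[of "\<lambda>_. 1"] by simp
    from less.hyps[OF this True] obtain d' \<psi>' where rep': "representation G d' \<psi>'"
      and d': "d' = (\<Sum>\<tau>\<in>small_types G. w' \<tau> * fst \<tau>)"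
      and def': "\<And>g. g \<in> carrier G - {\<one>\<^bsub>G\<^esub>} \<Longrightarrow> defect d' (\<psi>' g) = (\<Sum>\<tau>\<in>small_types G. w' \<tau> * snd \<tau> g)"
      by blast
    obtain \<phi> where \<phi>: "representation G (d' + d) \<phi>"
      and tr: "\<And>g. g \<in> carrier G \<Longrightarrow> mat_trace (\<phi> g) = mat_trace (\<psi>' g) + mat_trace (\<psi> g)"
      using direct_sum_representation[OF G(1) rep' rep] by blast
    have "d' + d = (\<Sum>\<tau>\<in>small_types G. w \<tau> * fst \<tau>)"
      unfolding split by (simp add: d' \<tau>_eq)
    moreover have "defect (d' + d) (\<phi> g) = (\<Sum>\<tau>\<in>small_types G. w \<tau> * snd \<tau> g)"
      if g: "g \<in> carrier G - {\<one>\<^bsub>G\<^esub>}" for g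
      unfolding split using defect_additive[OF G \<phi> rep' rep tr, of g] def'[OF g] g by (simp add: \<tau>_eq)
    ultimately show ?thesis using \<phi> by blast
  next
    case False
    hence "(\<Sum>\<sigma>\<in>small_types G. w' \<sigma> * c \<sigma>) = 0" for c by simp
    hence sum: "(\<Sum>\<sigma>\<in>small_types G. w \<sigma> * c \<sigma>) = c \<tau>" for c unfolding split by simp
    show ?thesis unfolding sum using rep by (intro exI[of _ d] exI[of _ \<psi>]) (simp add: \<tau>_eq)
  qed
qed

lemma trivial_representation: "group G \<Longrightarrow> representation G 1 (\<lambda>_. 1\<^sub>m 1)"
  by (rule representationI) auto

lemma min_rank_dist_le:
  assumes "finite (carrier G)" "g \<in> carrier G" "g \<noteq> \<one>\<^bsub>G\<^esub>"
  shows "min_rank_dist G d \<psi> \<le> real (defect d (\<psi> g)) / real d"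
proof -
  have "Min ((\<lambda>g. rank_dist d (\<psi> g) (1\<^sub>m d)) ` (carrier G - {\<one>\<^bsub>G\<^esub>})) \<le> rank_dist d (\<psi> g) (1\<^sub>m d)"
    using assms by (intro Min_le) auto
  moreover have "carrier G - {\<one>\<^bsub>G\<^esub>} \<noteq> {}" using assms by blast
  ultimately show ?thesis by (simp add: min_rank_dist_def rank_dist_def)
qed

text \<open>
  The bound by \<open>1\<close> is needed for the trivial group, where the minimum is \<open>1\<close> by convention.
\<close>

lemma le_min_rank_distI:
  assumes "finite (carrier G)" "c \<le> 1"
    "\<And>g. g \<in> carrier G \<Longrightarrow> g \<noteq> \<one>\<^bsub>G\<^esub> \<Longrightarrow> c \<le> real (defect d (\<psi> g)) / real d"
  shows "c \<le> min_rank_dist G d \<psi>"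
  using assms unfolding min_rank_dist_def rank_dist_def by auto

lemma min_rank_dist_in_Rats:
  assumes "finite (carrier G)"
  shows "min_rank_dist G d \<psi> \<in> \<rat>"
proof (cases "carrier G - {\<one>\<^bsub>G\<^esub>} = {}")
  case False
  hence "min_rank_dist G d \<psi> \<in> (\<lambda>g. rank_dist d (\<psi> g) (1\<^sub>m d)) ` (carrier G - {\<one>\<^bsub>G\<^esub>})"
    unfolding min_rank_dist_def using assms Min_in[of "(\<lambda>g. rank_dist d (\<psi> g) (1\<^sub>m d)) ` (carrier G - {\<one>\<^bsub>G\<^esub>})"]
    by simp
  thus ?thesis by (auto simp: rank_dist_def)
qed (simp add: min_rank_dist_def)

lemma defect_fraction_le_1: "real (defect d A) / real d \<le> 1"
proof -
  have "defect d A \<le> d"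
    by (rule rank_le_dim[of _ d d]) (rule minus_carrier_mat, simp)
  thus ?thesis by (cases "d = 0") (auto simp: divide_le_eq_1)
qed

lemma min_rank_dist_le_1:
  assumes "finite (carrier G)"
  shows "min_rank_dist G d \<psi> \<le> 1"
proof (cases "carrier G - {\<one>\<^bsub>G\<^esub>} = {}")
  case False
  then obtain g where "g \<in> carrier G" "g \<noteq> \<one>\<^bsub>G\<^esub>" by blast
  from min_rank_dist_le[OF assms this] show ?thesis
    using defect_fraction_le_1 by (rule order_trans)
qed (simp add: min_rank_dist_def)

lemma optimal_representation_exists:
  assumes G: "group G" "finite (carrier G)"
  shows "\<exists>d \<psi>. representation G d \<psi> \<and>
    (\<forall>d' \<psi>'. representation G d' \<psi>' \<longrightarrow> min_rank_dist G d' \<psi>' \<le> min_rank_dist G d \<psi>)"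
proof (cases "carrier G - {\<one>\<^bsub>G\<^esub>} = {}")
  case True
  thus ?thesis using trivial_representation[OF G(1)] by (auto simp: min_rank_dist_def)
next
  case False
  interpret group G by fact
  let ?T = "small_types G" and ?J = "carrier G - {\<one>\<^bsub>G\<^esub>}"
  have "(1, \<lambda>g\<in>?J. defect 1 (1\<^sub>m 1)) \<in> ?T"
  proof -
    have "0 < card (carrier G)" using G(2) by (auto simp: card_gt_0_iff)
    thus ?thesis using trivial_representation[OF G(1)] unfolding small_types_def by fastforce
  qed
  hence T: "finite ?T" "?T \<noteq> {}" using finite_small_types[OF G] by auto
  have J: "finite ?J" "?J \<noteq> {}" using G(2) False by auto
  have d1: "\<forall>\<tau>\<in>?T. fst \<tau> \<ge> 1"
    using representationD(1)[OF G(1)] by (auto simp: small_types_def)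
  obtain w t where wt: "(\<exists>\<tau>\<in>?T. 0 < w \<tau>) \<and>
      (\<forall>g\<in>?J. t * of_nat (\<Sum>\<tau>\<in>?T. w \<tau> * fst \<tau>) \<le> (of_nat (\<Sum>\<tau>\<in>?T. w \<tau> * snd \<tau> g) :: rat)) \<and>
      (\<forall>w'. (\<exists>\<tau>\<in>?T. 0 < w' \<tau>) \<longrightarrow>
        (\<exists>g\<in>?J. of_nat (\<Sum>\<tau>\<in>?T. w' \<tau> * snd \<tau> g) \<le> t * of_nat (\<Sum>\<tau>\<in>?T. w' \<tau> * fst \<tau>)))"
    using optimal_weights_exist[where d = fst and a = snd, OF T J d1] by (elim exE)
  note w = wt[THEN conjunct1] and opt = wt[THEN conjunct2, THEN conjunct1, rule_format]
    and best = wt[THEN conjunct2, THEN conjunct2, rule_format]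
  obtain d \<psi> where rep: "representation G d \<psi>" and d: "d = (\<Sum>\<tau>\<in>?T. w \<tau> * fst \<tau>)"
    and \<psi>: "\<And>g. g \<in> ?J \<Longrightarrow> defect d (\<psi> g) = (\<Sum>\<tau>\<in>?T. w \<tau> * snd \<tau> g)"
    using representation_of_weights[OF G w] by blast
  have d0: "d > 0" using representationD(1)[OF G(1) rep] by simp
  have to_real: "real_of_rat (t * of_nat n) = real_of_rat t * real n" "real_of_rat (of_nat n) = real n" for n
    by (simp_all add: of_rat_mult)
  have lower: "real_of_rat t \<le> real (defect d (\<psi> g)) / real d" if g: "g \<in> ?J" for g
  proof -
    have "real_of_rat (t * of_nat d) \<le> real_of_rat (of_nat (defect d (\<psi> g)))"
      using opt[OF g] unfolding of_rat_less_eq d[symmetric] \<psi>[OF g, symmetric] .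
    thus ?thesis unfolding to_real using d0 by (simp add: field_simps)
  qed
  have upper: "\<exists>g\<in>?J. real (defect d' (\<psi>' g)) / real d' \<le> real_of_rat t"
    if rep': "representation G d' \<psi>'" for d' \<psi>'
  proof -
    obtain w' where d': "d' = (\<Sum>\<tau>\<in>?T. w' \<tau> * fst \<tau>)"
      and \<psi>': "\<And>g. g \<in> ?J \<Longrightarrow> defect d' (\<psi>' g) = (\<Sum>\<tau>\<in>?T. w' \<tau> * snd \<tau> g)"
      using representation_weights[OF G rep'] by blast
    have d'0: "d' > 0" using representationD(1)[OF G(1) rep'] by simp
    hence "\<exists>\<tau>\<in>?T. 0 < w' \<tau>"
      unfolding d' by (rule contrapos_pp) simp
    from best[OF this] obtain g where g: "g \<in> ?J"
      "of_nat (\<Sum>\<tau>\<in>?T. w' \<tau> * snd \<tau> g) \<le> t * of_nat (\<Sum>\<tau>\<in>?T. w' \<tau> * fst \<tau>)" by blast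
    have "real_of_rat (of_nat (defect d' (\<psi>' g))) \<le> real_of_rat (t * of_nat d')"
      using g(2) unfolding of_rat_less_eq d'[symmetric] \<psi>'[OF g(1), symmetric] .
    thus ?thesis unfolding to_real using d'0 g(1) by (auto simp: field_simps)
  qed
  have "min_rank_dist G d' \<psi>' \<le> min_rank_dist G d \<psi>" if rep': "representation G d' \<psi>'" for d' \<psi>'
  proof -
    obtain g where g: "g \<in> ?J" "real (defect d' (\<psi>' g)) / real d' \<le> real_of_rat t"
      using upper[OF rep'] by blast
    have "min_rank_dist G d' \<psi>' \<le> real_of_rat t"
      using min_rank_dist_le[OF G(2), of g d' \<psi>'] g by simp
    also have "\<dots> \<le> min_rank_dist G d \<psi>"
    proof (rule le_min_rank_distI[OF G(2)])
      show "real_of_rat t \<le> 1"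
        by (rule order_trans[OF lower[OF g(1)] defect_fraction_le_1])
    qed (use lower in auto)
    finally show ?thesis .
  qed
  thus ?thesis using rep by blast
qed

section \<open>Almost representations restrict to representations\<close>

lemma representation_imp_linear_sofic:
  assumes G: "group G" "finite (carrier G)" and rep: "representation G d \<psi>"
    and \<kappa>: "\<kappa> \<le> min_rank_dist G d \<psi>"
  shows "linear_sofic G \<kappa>"
  unfolding linear_sofic_def
proof (intro allI impI)
  fix S and \<delta> \<kappa>' :: real assume *: "finite S \<and> S \<subseteq> carrier G \<and> 0 < \<delta> \<and> (0::real) \<le> \<kappa>' \<and> \<kappa>' < \<kappa>"
  note R = representationD[OF G(1) rep]
  have "\<psi> \<in> S \<rightarrow> carrier (GL d)" using rep * by (auto simp: representation_def hom_def)
  moreover have "rank_dist d (\<psi> (g \<otimes>\<^bsub>G\<^esub> h)) (\<psi> g * \<psi> h) < \<delta>" if "g \<in> S" "h \<in> S" for g h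
  proof -
    have gh: "g \<in> carrier G" "h \<in> carrier G" using that * by auto
    have "\<psi> g * \<psi> h - \<psi> g * \<psi> h = 0\<^sub>m d d" using R(2)[OF gh(1)] R(2)[OF gh(2)] by auto
    thus ?thesis using * by (simp add: rank_dist_def R(4)[OF gh] vec_space.rank_0I)
  qed
  moreover have "\<kappa>' \<le> rank_dist d (\<psi> g) (1\<^sub>m d)" if "g \<in> S - {\<one>\<^bsub>G\<^esub>}" for g
    using min_rank_dist_le[OF G(2), of g d \<psi>] that * \<kappa> by (auto simp: rank_dist_def)
  ultimately show "\<exists>d\<ge>1. \<exists>\<phi>. \<phi> \<in> S \<rightarrow> carrier (GL d) \<and>
      (\<forall>g\<in>S. \<forall>h\<in>S. g \<otimes>\<^bsub>G\<^esub> h \<in> S \<longrightarrow> rank_dist d (\<phi> (g \<otimes>\<^bsub>G\<^esub> h)) (\<phi> g * \<phi> h) < \<delta>) \<and>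
      (\<forall>g\<in>S - {\<one>\<^bsub>G\<^esub>}. \<kappa>' \<le> rank_dist d (\<phi> g) (1\<^sub>m d))"
    using R(1) by blast
qed

text \<open>
  The columns of \<open>B\<close> span the vectors \<open>v\<close> with \<open>\<phi>(e) v = v\<close> and \<open>\<phi>(gh) \<phi>(k) v = \<phi>(g) \<phi>(h) \<phi>(k) v\<close>.  Invariance
  under \<open>\<phi>(l)\<close> holds because \<open>\<phi>(k) \<phi>(l) v = \<phi>(kl) v\<close>, which turns the condition for \<open>\<phi>(l) v\<close> and \<open>k\<close> into the
  condition for \<open>v\<close> and \<open>kl\<close>.
\<close>

lemma almost_representation_restricts:
  assumes G: "group G" "finite (carrier G)" and \<delta>: "0 < \<delta>"
    and small: "real (card (carrier G) ^ 3 + 1) * \<delta> < 1"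
    and d: "d \<ge> 1" and \<phi>: "\<phi> \<in> carrier G \<rightarrow> carrier (GL d)"
    and almost: "\<And>g h. g \<in> carrier G \<Longrightarrow> h \<in> carrier G \<Longrightarrow>
      rank_dist d (\<phi> (g \<otimes>\<^bsub>G\<^esub> h)) (\<phi> g * \<phi> h) < \<delta>"
  shows "\<exists>m \<psi>. representation G m \<psi> \<and> m \<le> d \<and>
    (\<forall>g\<in>carrier G. real (defect d (\<phi> g)) \<le>
      real (defect m (\<psi> g)) + real (card (carrier G) ^ 3 + 1) * \<delta> * real d)"
proof -
  interpret group G by fact
  have car: "\<phi> g \<in> carrier_mat d d" if "g \<in> carrier G" for g
    using \<phi> that by (auto simp: carrier_GL)
  \<comment> \<open>One matrix for the condition at the identity and one for each triple.\<close>
  define M where "M = (\<lambda>i. case i of None \<Rightarrow> 1\<^sub>m d - \<phi> \<one>\<^bsub>G\<^esub>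
    | Some (g, h, k) \<Rightarrow> (\<phi> (g \<otimes>\<^bsub>G\<^esub> h) - \<phi> g * \<phi> h) * \<phi> k)"
  define I where "I = insert None (Some ` (carrier G \<times> carrier G \<times> carrier G))"
  have finI: "finite I" using G(2) by (simp add: I_def)
  have cardI: "card I = card (carrier G) ^ 3 + 1"
    using G(2) unfolding I_def
    by (subst card_insert_disjoint) (auto simp: card_image card_cartesian_product power3_eq_cube)
  have Mdiff: "\<phi> (g \<otimes>\<^bsub>G\<^esub> h) - \<phi> g * \<phi> h \<in> carrier_mat d d" if "g \<in> carrier G" "h \<in> carrier G" for g h
    by (rule minus_carrier_mat[OF mult_carrier_mat[OF car[OF that(1)] car[OF that(2)]]])
  have Mc: "M i \<in> carrier_mat d d" if "i \<in> I" for i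
    using that minus_carrier_mat[OF car[OF one_closed]] mult_carrier_mat[OF Mdiff car]
    unfolding I_def M_def by auto
  have Mc': "\<forall>i\<in>I. M i \<in> carrier_mat d d" using Mc by (rule ballI)
  have rdiff: "real (vec_space.rank d (\<phi> (g \<otimes>\<^bsub>G\<^esub> h) - \<phi> g * \<phi> h)) \<le> \<delta> * real d"
    if "g \<in> carrier G" "h \<in> carrier G" for g h
    using almost[OF that] d by (simp add: rank_dist_def field_simps)
  have rM: "real (vec_space.rank d (M i)) \<le> \<delta> * real d" if i: "i \<in> I" for i
  proof (cases i)
    case None
    have "\<phi> \<one>\<^bsub>G\<^esub> \<in> carrier (GL d)" using \<phi> by auto
    then obtain B where B: "B * \<phi> \<one>\<^bsub>G\<^esub> = 1\<^sub>m (dim_row B)" and B': "\<phi> \<one>\<^bsub>G\<^esub> * B = 1\<^sub>m d"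
      using car[OF one_closed] by (auto simp: carrier_GL invertible_mat_def inverts_mat_def)
    have "dim_col B = d" using arg_cong[OF B', of dim_col] by simp
    moreover have "dim_row B = d"
      using arg_cong[OF B, of dim_col] car[OF one_closed] by simp
    ultimately have Bc: "B \<in> carrier_mat d d" by blast
    \<comment> \<open>Almost multiplicativity at \<open>(e, e)\<close> bounds \<open>\<phi>(e) - \<phi>(e) \<phi>(e)\<close>, and \<open>\<phi>(e)\<close> is invertible.\<close>
    have "B * (\<phi> (\<one>\<^bsub>G\<^esub> \<otimes>\<^bsub>G\<^esub> \<one>\<^bsub>G\<^esub>) - \<phi> \<one>\<^bsub>G\<^esub> * \<phi> \<one>\<^bsub>G\<^esub>) =
        B * \<phi> \<one>\<^bsub>G\<^esub> - (B * \<phi> \<one>\<^bsub>G\<^esub>) * \<phi> \<one>\<^bsub>G\<^esub>"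
      using Bc car[OF one_closed] by (simp add: mat_algebra)
    also have "\<dots> = M i"
      unfolding B using None Bc car[OF one_closed] by (simp add: M_def mat_algebra)
    finally have "vec_space.rank d (M i) \<le> vec_space.rank d (\<phi> (\<one>\<^bsub>G\<^esub> \<otimes>\<^bsub>G\<^esub> \<one>\<^bsub>G\<^esub>) - \<phi> \<one>\<^bsub>G\<^esub> * \<phi> \<one>\<^bsub>G\<^esub>)"
      using rank_mult_le_right[OF Bc Mdiff] by (metis one_closed)
    with rdiff[OF one_closed one_closed] show ?thesis by linarith
  next
    case (Some q)
    then obtain g h k where q: "i = Some (g, h, k)" by (cases q) auto
    hence ghk: "g \<in> carrier G" "h \<in> carrier G" "k \<in> carrier G" using i by (auto simp: I_def)
    have "vec_space.rank d (M i) \<le> vec_space.rank d (\<phi> (g \<otimes>\<^bsub>G\<^esub> h) - \<phi> g * \<phi> h)"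
      unfolding q M_def using rank_mult_le_left[OF Mdiff[OF ghk(1,2)] car[OF ghk(3)]] by simp
    with rdiff[OF ghk(1,2)] show ?thesis by linarith
  qed
  have "real (\<Sum>i\<in>I. vec_space.rank d (M i)) \<le> (\<Sum>i\<in>I. \<delta> * real d)"
    unfolding of_nat_sum by (rule sum_mono) (rule rM)
  hence codim: "real (\<Sum>i\<in>I. vec_space.rank d (M i)) \<le> real (card (carrier G) ^ 3 + 1) * \<delta> * real d"
    by (simp add: cardI mult.assoc del: of_nat_add of_nat_power)
  obtain m B L where kernel: "B \<in> carrier_mat d m \<and> L \<in> carrier_mat m d \<and> L * B = 1\<^sub>m m \<and>
    (\<forall>i\<in>I. M i * B = 0\<^sub>m d m) \<and>
    (\<forall>c. \<forall>C\<in>carrier_mat d c. (\<forall>i\<in>I. M i * C = 0\<^sub>m d c) \<longrightarrow> B * (L * C) = C) \<and>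
    d \<le> m + (\<Sum>i\<in>I. vec_space.rank d (M i))"
    using common_kernel_basis[OF finI Mc'] by (elim exE)
  hence B: "B \<in> carrier_mat d m" and L: "L \<in> carrier_mat m d" and LB: "L * B = 1\<^sub>m m"
    and MB: "\<And>i. i \<in> I \<Longrightarrow> M i * B = 0\<^sub>m d m"
    and m: "d \<le> m + (\<Sum>i\<in>I. vec_space.rank d (M i))" by simp_all
  have univ: "B * (L * C) = C" if "C \<in> carrier_mat d c" "\<And>i. i \<in> I \<Longrightarrow> M i * C = 0\<^sub>m d c" for c C
    using kernel that by blast
  have "real (card (carrier G) ^ 3 + 1) * \<delta> * real d < 1 * real d"
    by (rule mult_strict_right_mono[OF small]) (use d in simp)
  hence "(\<Sum>i\<in>I. vec_space.rank d (M i)) < d" using codim by linarith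
  hence m1: "m \<ge> 1" using m by simp
  have md: "m \<le> d" by (rule left_invertible_rank(2)[OF B L LB])
  note dBL = carrier_matD[OF B] carrier_matD[OF L]
  note dcar = carrier_matD[OF car]
  have diff0: "X = Y" if "X - Y = 0\<^sub>m p q" "X \<in> carrier_mat p q" "Y \<in> carrier_mat p q" for X Y :: "complex mat" and p q
  proof (rule eq_matI)
    fix i j assume ij: "i < dim_row Y" "j < dim_col Y"
    note dims = carrier_matD[OF that(2)] carrier_matD[OF that(3)]
    have "(X - Y) $$ (i, j) = 0" unfolding that(1) using ij dims by simp
    thus "X $$ (i, j) = Y $$ (i, j)" using ij dims by simp
  qed (use that in auto)
  have oneB: "\<phi> \<one>\<^bsub>G\<^esub> * B = B"
  proof (rule diff0[symmetric])
    have "M None * B = B - \<phi> \<one>\<^bsub>G\<^esub> * B"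
      unfolding M_def using B car[OF one_closed] by (simp add: mat_algebra)
    thus "B - \<phi> \<one>\<^bsub>G\<^esub> * B = 0\<^sub>m d m" using MB[of None] by (simp add: I_def)
  qed (use B car[OF one_closed] in auto)
  have multB3: "\<phi> (g \<otimes>\<^bsub>G\<^esub> h) * (\<phi> k * B) = \<phi> g * (\<phi> h * (\<phi> k * B))"
    if g: "g \<in> carrier G" and h: "h \<in> carrier G" and k: "k \<in> carrier G" for g h k
  proof (rule diff0)
    have "M (Some (g, h, k)) * B = \<phi> (g \<otimes>\<^bsub>G\<^esub> h) * (\<phi> k * B) - \<phi> g * (\<phi> h * (\<phi> k * B))"
      unfolding M_def using g h k by (simp add: mat_algebra dBL dcar)
    thus "\<phi> (g \<otimes>\<^bsub>G\<^esub> h) * (\<phi> k * B) - \<phi> g * (\<phi> h * (\<phi> k * B)) = 0\<^sub>m d m"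
      using MB[of "Some (g, h, k)"] g h k by (simp add: I_def)
  qed (use g h k B in \<open>auto intro!: mult_carrier_mat car\<close>)
  have multB: "\<phi> (g \<otimes>\<^bsub>G\<^esub> h) * B = \<phi> g * (\<phi> h * B)"
    if "g \<in> carrier G" "h \<in> carrier G" for g h
    using multB3[OF that one_closed] unfolding oneB .
  define \<psi> where "\<psi> = (\<lambda>g. L * (\<phi> g * B))"
  have inv: "B * \<psi> l = \<phi> l * B" if l: "l \<in> carrier G" for l
    unfolding \<psi>_def
  proof (rule univ)
    show "\<phi> l * B \<in> carrier_mat d m" using car[OF l] B by simp
    fix i assume i: "i \<in> I"
    show "M i * (\<phi> l * B) = 0\<^sub>m d m"
    proof (cases i)
      case None
      have "\<phi> \<one>\<^bsub>G\<^esub> * (\<phi> l * B) = \<phi> l * B"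
        using multB[OF one_closed l] l by simp
      hence "M i * (\<phi> l * B) = \<phi> l * B - \<phi> l * B"
        unfolding None M_def using l by (simp add: mat_algebra dBL dcar)
      thus ?thesis using car[OF l] B by auto
    next
      case (Some q)
      then obtain g h k where q: "i = Some (g, h, k)" by (cases q) auto
      hence ghk: "g \<in> carrier G" "h \<in> carrier G" "k \<in> carrier G" using i by (auto simp: I_def)
      have "M i * (\<phi> l * B) = (\<phi> (g \<otimes>\<^bsub>G\<^esub> h) - \<phi> g * \<phi> h) * (\<phi> k * (\<phi> l * B))"
        unfolding q M_def using ghk l by (simp add: mult_mat_assoc dBL dcar)
      also have "\<phi> k * (\<phi> l * B) = \<phi> (k \<otimes>\<^bsub>G\<^esub> l) * B" using multB[OF ghk(3) l] by simp
      also have "(\<phi> (g \<otimes>\<^bsub>G\<^esub> h) - \<phi> g * \<phi> h) * (\<phi> (k \<otimes>\<^bsub>G\<^esub> l) * B) = M (Some (g, h, k \<otimes>\<^bsub>G\<^esub> l)) * B"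
        unfolding M_def using ghk l by (simp add: mult_mat_assoc dBL dcar)
      also have "\<dots> = 0\<^sub>m d m" using ghk l by (intro MB) (simp add: I_def)
      finally show ?thesis .
    qed
  qed
  have \<psi>c: "\<psi> g \<in> carrier_mat m m" if "g \<in> carrier G" for g
    using car[OF that] B L by (simp add: \<psi>_def)
  have rep: "representation G m \<psi>"
  proof (rule representationI[OF G(1) m1])
    show "\<psi> \<one>\<^bsub>G\<^esub> = 1\<^sub>m m" unfolding \<psi>_def oneB by (rule LB)
    fix g h assume g: "g \<in> carrier G" and h: "h \<in> carrier G"
    show "\<psi> g \<in> carrier_mat m m" by (rule \<psi>c[OF g])
    have "\<psi> (g \<otimes>\<^bsub>G\<^esub> h) = L * (\<phi> g * (B * \<psi> h))"
      unfolding inv[OF h] by (simp add: \<psi>_def multB[OF g h])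
    also have "\<dots> = \<psi> g * \<psi> h"
      using g h \<psi>c[OF h] by (simp add: \<psi>_def mult_mat_assoc dBL dcar)
    finally show "\<psi> (g \<otimes>\<^bsub>G\<^esub> h) = \<psi> g * \<psi> h" .
  qed
  have "real (defect d (\<phi> g)) \<le> real (defect m (\<psi> g)) + real (card (carrier G) ^ 3 + 1) * \<delta> * real d"
    if g: "g \<in> carrier G" for g
  proof -
    have BL: "B * L \<in> carrier_mat d d" using B L by simp
    have BLBL: "(B * L) * (B * L) = B * L"
    proof -
      have "(B * L) * (B * L) = B * ((L * B) * L)" by (simp add: mat_algebra dBL)
      thus ?thesis unfolding LB by (simp add: mat_algebra dBL)
    qed
    have "of_nat (vec_space.rank d (B * L)) = (of_nat m :: complex)"
      using rank_idempotent[OF BL BLBL] mat_trace_mult_comm[OF B L] by (simp add: LB)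
    hence rBL: "vec_space.rank d (1\<^sub>m d - B * L) = d - m"
      by (simp add: rank_complement[OF BL BLBL])
    have c1: "\<phi> g - 1\<^sub>m d \<in> carrier_mat d d" and c2: "1\<^sub>m d - B * L \<in> carrier_mat d d"
      and c3: "\<psi> g - 1\<^sub>m m \<in> carrier_mat m m"
      using BL by (auto intro!: minus_carrier_mat)
    have BL_add: "B * L + (1\<^sub>m d - B * L) = 1\<^sub>m d" by (intro eq_matI) (auto simp: dBL)
    have "(\<phi> g - 1\<^sub>m d) * (B * L) = (\<phi> g * B - B) * L"
      using g by (simp add: mat_algebra dBL dcar)
    also have "\<phi> g * B - B = B * (\<psi> g - 1\<^sub>m m)"
      using \<psi>c[OF g] by (simp add: mat_algebra dBL inv[OF g])
    finally have "vec_space.rank d ((\<phi> g - 1\<^sub>m d) * (B * L)) \<le> vec_space.rank d (B * (\<psi> g - 1\<^sub>m m))"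
      using rank_mult_le_left[OF mult_carrier_mat[OF B c3] L] by simp
    also have "\<dots> \<le> defect m (\<psi> g)" by (rule rank_mult_le_right[OF B c3])
    finally have le1: "vec_space.rank d ((\<phi> g - 1\<^sub>m d) * (B * L)) \<le> defect m (\<psi> g)" .
    have le2: "vec_space.rank d ((\<phi> g - 1\<^sub>m d) * (1\<^sub>m d - B * L)) \<le> d - m"
      using rank_mult_le_right[OF c1 c2] rBL by simp
    have "(\<phi> g - 1\<^sub>m d) * (B * L) + (\<phi> g - 1\<^sub>m d) * (1\<^sub>m d - B * L) = \<phi> g - 1\<^sub>m d"
      using c1 c2 BL by (subst mult_mat_add_right[symmetric]) (auto simp: BL_add)
    hence "defect d (\<phi> g) \<le> defect m (\<psi> g) + (d - m)"
      using rank_add_le[OF mult_carrier_mat[OF c1 BL] mult_carrier_mat[OF c1 c2]] le1 le2 by simp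
    moreover have "d - m \<le> (\<Sum>i\<in>I. vec_space.rank d (M i))" using m by simp
    ultimately have "defect d (\<phi> g) \<le> defect m (\<psi> g) + (\<Sum>i\<in>I. vec_space.rank d (M i))" by simp
    hence "real (defect d (\<phi> g)) \<le> real (defect m (\<psi> g)) + real (\<Sum>i\<in>I. vec_space.rank d (M i))"
      by (simp only: of_nat_add[symmetric] of_nat_le_iff)
    with codim show ?thesis by linarith
  qed
  thus ?thesis using rep md by blast
qed

text \<open>
  Since the restricted dimension \<open>m\<close> is at most \<open>d\<close>, dividing a rank by \<open>m\<close> instead of \<open>d\<close> only
  increases the quotient, and the loss of rank is at most \<open>\<epsilon> d\<close>.
\<close>

lemma linear_sofic_imp_representation:
  assumes G: "group G" "finite (carrier G)" and sofic: "linear_sofic G \<kappa>"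
    and \<kappa>': "0 \<le> \<kappa>'" "\<kappa>' < \<kappa>" and \<epsilon>: "0 < \<epsilon>"
  shows "\<exists>d \<psi>. representation G d \<psi> \<and>
    (\<forall>g\<in>carrier G - {\<one>\<^bsub>G\<^esub>}. \<kappa>' - \<epsilon> \<le> real (defect d (\<psi> g)) / real d)"
proof -
  define c where "c = real (card (carrier G) ^ 3 + 1)"
  have c: "c > 0" unfolding c_def of_nat_0_less_iff by simp
  \<comment> \<open>The bound by \<open>1/2\<close> keeps the restricted representation nonzero.\<close>
  define \<delta> where "\<delta> = min \<epsilon> (1 / 2) / c"
  have \<delta>: "0 < \<delta>" "c * \<delta> < 1" "c * \<delta> \<le> \<epsilon>" using c \<epsilon> by (auto simp: \<delta>_def)
  obtain d \<phi> where d: "d \<ge> 1" and \<phi>: "\<phi> \<in> carrier G \<rightarrow> carrier (GL d)"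
    and AH: "\<And>g h. g \<in> carrier G \<Longrightarrow> h \<in> carrier G \<Longrightarrow> g \<otimes>\<^bsub>G\<^esub> h \<in> carrier G \<Longrightarrow>
      rank_dist d (\<phi> (g \<otimes>\<^bsub>G\<^esub> h)) (\<phi> g * \<phi> h) < \<delta>"
    and D: "\<And>g. g \<in> carrier G - {\<one>\<^bsub>G\<^esub>} \<Longrightarrow> \<kappa>' \<le> rank_dist d (\<phi> g) (1\<^sub>m d)"
    using sofic[unfolded linear_sofic_def, rule_format, of "carrier G" \<delta> \<kappa>'] G(2) \<delta>(1) \<kappa>' by blast
  interpret group G by fact
  obtain m \<psi> where rep: "representation G m \<psi>" and md: "m \<le> d"
    and def: "\<And>g. g \<in> carrier G \<Longrightarrow> real (defect d (\<phi> g)) \<le> real (defect m (\<psi> g)) + c * \<delta> * real d"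
    using almost_representation_restricts[OF G \<delta>(1) \<delta>(2)[unfolded c_def] d \<phi> AH] unfolding c_def by auto
  have m: "m \<ge> 1" by (rule representationD(1)[OF G(1) rep])
  have "\<kappa>' - \<epsilon> \<le> real (defect m (\<psi> g)) / real m" if g: "g \<in> carrier G - {\<one>\<^bsub>G\<^esub>}" for g
  proof (cases "\<kappa>' - \<epsilon> \<le> 0")
    case True
    also have "0 \<le> real (defect m (\<psi> g)) / real m" by simp
    finally show ?thesis .
  next
    case False
    have "\<kappa>' * real d \<le> real (defect d (\<phi> g))"
      using D[OF g] d by (simp add: rank_dist_def field_simps)
    also have "\<dots> \<le> real (defect m (\<psi> g)) + c * \<delta> * real d" using def g by simp
    also have "c * \<delta> * real d \<le> \<epsilon> * real d" using \<delta>(3) by (intro mult_right_mono) auto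
    finally have "(\<kappa>' - \<epsilon>) * real d \<le> real (defect m (\<psi> g))" by (simp add: algebra_simps)
    moreover have "(\<kappa>' - \<epsilon>) * real m \<le> (\<kappa>' - \<epsilon>) * real d"
      using False md by (intro mult_left_mono) auto
    ultimately show ?thesis using m by (simp add: field_simps)
  qed
  thus ?thesis using rep by blast
qed

section \<open>The linear sofic constant of a finite group\<close>

text \<open>
  The regular representation guarantees a positive optimum, so that the optimum itself belongs to the
  set whose supremum defines \<open>\<kappa>(G)\<close>.
\<close>

lemma sofic_kappa_eq:
  assumes G: "group G" "finite (carrier G)" and rep: "representation G d \<psi>"
    and opt: "\<And>d' \<psi>'. representation G d' \<psi>' \<Longrightarrow> min_rank_dist G d' \<psi>' \<le> min_rank_dist G d \<psi>"
  shows "sofic_kappa G = min_rank_dist G d \<psi>"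
proof -
  interpret group G by fact
  let ?m = "min_rank_dist G d \<psi>"
  define K where "K = {\<kappa>. 0 < \<kappa> \<and> \<kappa> \<le> 1 \<and> linear_sofic G \<kappa>}"
  have "0 < ?m"
  proof -
    obtain \<rho> where \<rho>: "representation G (card (carrier G)) \<rho>"
      and tr: "\<And>g. g \<in> carrier G \<Longrightarrow> mat_trace (\<rho> g) = (if g = \<one>\<^bsub>G\<^esub> then of_nat (card (carrier G)) else 0)"
      using regular_representation[OF G] by blast
    let ?N = "card (carrier G)"
    have N: "?N > 0" using representationD(1)[OF G(1) \<rho>] by simp
    have "1 / real ?N \<le> min_rank_dist G ?N \<rho>"
    proof (rule le_min_rank_distI[OF G(2)])
      show "1 / real ?N \<le> 1" using N by simp
      fix g assume g: "g \<in> carrier G" "g \<noteq> \<one>\<^bsub>G\<^esub>"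
      have "defect ?N (\<rho> g) \<noteq> 0"
      proof
        have c: "\<rho> g \<in> carrier_mat ?N ?N" using representationD(2)[OF G(1) \<rho>] g by simp
        assume "defect ?N (\<rho> g) = 0"
        hence "\<rho> g - 1\<^sub>m ?N = 0\<^sub>m ?N ?N" by (intro rank_eq_0 minus_carrier_mat) auto
        hence "mat_trace (\<rho> g - 1\<^sub>m ?N) = 0" by (simp add: mat_trace_def)
        thus False using tr g N by (simp add: mat_trace_diff[OF c one_carrier_mat])
      qed
      thus "1 / real ?N \<le> real (defect ?N (\<rho> g)) / real ?N"
        by (intro divide_right_mono) auto
    qed
    also have "\<dots> \<le> ?m" by (rule opt[OF \<rho>])
    finally have "1 / real ?N \<le> ?m" .
    moreover have "0 < 1 / real ?N" using N by simp
    ultimately show ?thesis by linarith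
  qed
  hence mK: "?m \<in> K"
    unfolding K_def using min_rank_dist_le_1[OF G(2)] representation_imp_linear_sofic[OF G rep order_refl]
    by simp
  have "\<kappa> \<le> ?m" if \<kappa>: "\<kappa> \<in> K" for \<kappa>
  proof (rule ccontr)
    assume "\<not> \<kappa> \<le> ?m"
    hence less: "?m < \<kappa>" by simp
    \<comment> \<open>The midpoint leaves room for a further loss of a quarter of the gap.\<close>
    define \<kappa>' where "\<kappa>' = (\<kappa> + ?m) / 2"
    have "0 \<le> \<kappa>'" "\<kappa>' < \<kappa>" "0 < (\<kappa>' - ?m) / 2" using less \<open>0 < ?m\<close> by (auto simp: \<kappa>'_def)
    then obtain d' \<psi>' where rep': "representation G d' \<psi>'"
      and D: "\<And>g. g \<in> carrier G - {\<one>\<^bsub>G\<^esub>} \<Longrightarrow> \<kappa>' - (\<kappa>' - ?m) / 2 \<le> real (defect d' (\<psi>' g)) / real d'"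
      using linear_sofic_imp_representation[OF G] \<kappa> unfolding K_def by blast
    have "\<kappa>' - (\<kappa>' - ?m) / 2 \<le> min_rank_dist G d' \<psi>'"
    proof (rule le_min_rank_distI[OF G(2)])
      show "\<kappa>' - (\<kappa>' - ?m) / 2 \<le> 1" using \<kappa> less unfolding K_def \<kappa>'_def by (auto simp: field_simps)
    qed (use D in auto)
    also have "\<dots> \<le> ?m" by (rule opt[OF rep'])
    finally show False using less by (simp add: \<kappa>'_def field_simps)
  qed
  hence "Sup K = ?m" by (intro cSup_eq_maximum mK)
  thus ?thesis using mK unfolding sofic_kappa_def K_def[symmetric] by (auto simp: Let_def)
qed

lemma eigenvalue_1_iff_defect:
  assumes A: "A \<in> carrier_mat d d"
  shows "eigenvalue A 1 \<longleftrightarrow> defect d A \<noteq> d"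
proof -
  have "char_matrix A 1 = A - 1\<^sub>m d"
    unfolding char_matrix_def using A by (intro eq_matI) auto
  moreover have "A - 1\<^sub>m d \<in> carrier_mat d d" by (rule minus_carrier_mat) simp
  ultimately show ?thesis
    using eigenvalue_det[OF A, of 1] vec_space.det_rank_iff[of "A - 1\<^sub>m d" d] by metis
qed

lemma min_rank_dist_eq_1_iff:
  assumes G: "group G" "finite (carrier G)" and rep: "representation G d \<psi>"
  shows "min_rank_dist G d \<psi> = 1 \<longleftrightarrow> fixed_point_free G \<psi>"
proof -
  note R = representationD[OF G(1) rep]
  have d: "d > 0" using R(1) by simp
  show ?thesis
  proof
    assume one: "min_rank_dist G d \<psi> = 1"
    have "\<not> eigenvalue (\<psi> g) 1" if g: "g \<in> carrier G - {\<one>\<^bsub>G\<^esub>}" for g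
    proof -
      have "1 \<le> real (defect d (\<psi> g)) / real d"
        using min_rank_dist_le[OF G(2), of g d \<psi>] g one by simp
      with defect_fraction_le_1[of d "\<psi> g"] have "real (defect d (\<psi> g)) / real d = 1" by linarith
      hence "defect d (\<psi> g) = d" using d by simp
      thus ?thesis using eigenvalue_1_iff_defect[OF R(2)] g by simp
    qed
    thus "fixed_point_free G \<psi>" by (simp add: fixed_point_free_def)
  next
    assume fpf: "fixed_point_free G \<psi>"
    have "1 \<le> min_rank_dist G d \<psi>"
    proof (rule le_min_rank_distI[OF G(2)])
      fix g assume g: "g \<in> carrier G" "g \<noteq> \<one>\<^bsub>G\<^esub>"
      hence "defect d (\<psi> g) = d"
        using fpf eigenvalue_1_iff_defect[OF R(2)[OF g(1)]] by (auto simp: fixed_point_free_def)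
      thus "1 \<le> real (defect d (\<psi> g)) / real d" using d by simp
    qed simp
    with min_rank_dist_le_1[OF G(2), of d \<psi>] show "min_rank_dist G d \<psi> = 1" by simp
  qed
qed

section \<open>Elementary abelian groups\<close>

text \<open>
  By \<open>defect_character\<close> the sum is \<open>d |G|\<close> minus \<open>1/p\<close> times the total of the sums of the characters
  \<open>\<psi>(g\<^sup>k)\<close>, \<open>k < p\<close>.  All of these are non-negative because \<open>g \<mapsto> g\<^sup>k\<close> is an endomorphism, and the one for
  \<open>k = 0\<close> is \<open>d |G|\<close>.
\<close>

lemma sum_defect_exponent_le:
  assumes G: "comm_group G" "finite (carrier G)" and p: "p > 0"
    and exponent: "\<And>g. g \<in> carrier G \<Longrightarrow> g [^]\<^bsub>G\<^esub> p = \<one>\<^bsub>G\<^esub>"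
    and rep: "representation G d \<psi>"
  shows "(\<Sum>g\<in>carrier G. real (defect d (\<psi> g))) \<le>
    real d * (real (card (carrier G)) - real (card (carrier G)) / real p)"
proof -
  interpret comm_group G by fact
  have grp: "group G" by (rule group_axioms)
  note R = representationD[OF grp rep]
  let ?q = "card (carrier G)"
  have q: "?q > 0" using G(2) one_closed card_gt_0_iff by blast
  have power_sum: "\<exists>n. (\<Sum>g\<in>carrier G. mat_trace (\<psi> (g [^]\<^bsub>G\<^esub> k))) = of_nat (?q * n)" for k :: nat
  proof -
    have "representation G d (\<lambda>g. \<psi> (g [^]\<^bsub>G\<^esub> k))"
      by (rule representationI[OF grp R(1)]) (auto simp: R nat_pow_distrib)
    from average_representation(4)[OF grp G(2) this refl] q show ?thesis
      by (intro exI[of _ "vec_space.rank d (inverse (of_nat ?q) \<cdot>\<^sub>m mat_sum d (\<lambda>g. \<psi> (g [^]\<^bsub>G\<^esub> k)) (carrier G))"])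
         (simp add: field_simps)
  qed
  hence "\<forall>k :: nat. \<exists>n. (\<Sum>g\<in>carrier G. mat_trace (\<psi> (g [^]\<^bsub>G\<^esub> k))) = of_nat (?q * n)" by (rule allI)
  from choice[OF this] obtain n :: "nat \<Rightarrow> nat"
    where n: "(\<Sum>g\<in>carrier G. mat_trace (\<psi> (g [^]\<^bsub>G\<^esub> k))) = of_nat (?q * n k)" for k :: nat
    by (elim exE) blast
  have "of_nat (?q * n 0) = (of_nat (?q * d) :: complex)"
    using n[of 0, symmetric] by (simp add: R(3))
  hence "?q * n 0 = ?q * d" by (simp only: of_nat_eq_iff)
  hence n0: "n 0 = d" using q by (simp only: mult_cancel1) simp
  have "(\<Sum>g\<in>carrier G. of_nat (defect d (\<psi> g))) =
      (\<Sum>g\<in>carrier G. of_nat d - (\<Sum>k<p. mat_trace (\<psi> (g [^]\<^bsub>G\<^esub> k))) / of_nat p)"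
    by (rule sum.cong[OF refl], rule defect_character[OF grp rep _ p exponent])
  also have "\<dots> = of_nat (?q * d) - (\<Sum>g\<in>carrier G. \<Sum>k<p. mat_trace (\<psi> (g [^]\<^bsub>G\<^esub> k))) / of_nat p"
    by (simp add: sum_subtractf sum_divide_distrib)
  also have "(\<Sum>g\<in>carrier G. \<Sum>k<p. mat_trace (\<psi> (g [^]\<^bsub>G\<^esub> k))) = of_nat (\<Sum>k<p. ?q * n k)"
    by (subst sum.swap) (simp add: n)
  finally have "complex_of_real (\<Sum>g\<in>carrier G. real (defect d (\<psi> g))) =
      complex_of_real (real (?q * d) - real (\<Sum>k<p. ?q * n k) / real p)"
    by simp
  hence eq: "(\<Sum>g\<in>carrier G. real (defect d (\<psi> g))) = real (?q * d) - real (\<Sum>k<p. ?q * n k) / real p"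
    by (simp only: of_real_eq_iff)
  have "?q * n 0 \<le> (\<Sum>k<p. ?q * n k)" using p by (intro member_le_sum) auto
  hence "real (?q * d) \<le> real (\<Sum>k<p. ?q * n k)" unfolding n0 of_nat_le_iff .
  hence "real (?q * d) / real p \<le> real (\<Sum>k<p. ?q * n k) / real p" by (rule divide_right_mono) simp
  thus ?thesis unfolding eq by (simp add: algebra_simps)
qed

text \<open>
  For the regular representation minus the trivial one, the characters at the powers \<open>g\<^sup>k\<close> are \<open>|G| - 1\<close>
  for \<open>k = 0\<close> and \<open>-1\<close> for \<open>0 < k < p\<close>, so all elements other than the identity have the same rank.  No
  representation does better, because the minimum is at most the average.
\<close>

lemma sofic_kappa_elementary_abelian:
  assumes G: "comm_group G" "finite (carrier G)" "card (carrier G) > 1" and p: "Factorial_Ring.prime p"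
    and exponent: "\<And>g. g \<in> carrier G \<Longrightarrow> g [^]\<^bsub>G\<^esub> p = \<one>\<^bsub>G\<^esub>"
  shows "sofic_kappa G =
    (real (card (carrier G)) - real (card (carrier G)) / real p) / (real (card (carrier G)) - 1)"
proof -
  interpret comm_group G by fact
  have grp: "group G" by (rule group_axioms)
  let ?q = "card (carrier G)" and ?J = "carrier G - {\<one>\<^bsub>G\<^esub>}"
  define c where "c = (real ?q - real ?q / real p) / (real ?q - 1)"
  have p0: "p > 0" using p by (simp add: prime_gt_0_nat)
  have cardJ: "card ?J = ?q - 1" using G(2) by simp
  hence J: "?J \<noteq> {}" using G(3) by force
  obtain \<psi> where rep: "representation G (?q - 1) \<psi>"
    and tr: "\<And>g. g \<in> carrier G \<Longrightarrow> mat_trace (\<psi> g) = (if g = \<one>\<^bsub>G\<^esub> then of_nat ?q else 0) - 1"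
    using regular_minus_trivial_representation[OF grp G(2,3)] by blast
  have defect: "real (defect (?q - 1) (\<psi> g)) / real (?q - 1) = c" if g: "g \<in> ?J" for g
  proof -
    have gc: "g \<in> carrier G" and g1: "g \<noteq> \<one>\<^bsub>G\<^esub>" using g by auto
    have "ord g dvd p" using exponent[OF gc] by (simp add: pow_eq_id[OF gc])
    hence "ord g = 1 \<or> ord g = p" using p by (simp add: prime_nat_iff)
    moreover have "ord g \<noteq> 1" using pow_eq_id[OF gc, of 1] gc g1 by auto
    ultimately have ord: "ord g = p" by simp
    have trk: "mat_trace (\<psi> (g [^]\<^bsub>G\<^esub> k)) = - 1" if "k \<in> {1..<p}" for k
    proof -
      have "\<not> p dvd k" using that by (auto dest: dvd_imp_le)
      hence "g [^]\<^bsub>G\<^esub> k \<noteq> \<one>\<^bsub>G\<^esub>" using pow_eq_id[OF gc, of k] ord by simp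
      thus ?thesis using tr gc by simp
    qed
    have "{..<p} = insert 0 {1..<p}" using p0 by auto
    hence "(\<Sum>k<p. mat_trace (\<psi> (g [^]\<^bsub>G\<^esub> k))) = (of_nat ?q - 1) + (\<Sum>k\<in>{1..<p}. - 1)"
      using trk tr[of "\<one>\<^bsub>G\<^esub>"] by simp
    also have "\<dots> = of_nat ?q - of_nat p"
      using p0 by (simp add: of_nat_diff)
    finally have "complex_of_nat (defect (?q - 1) (\<psi> g)) =
        of_nat (?q - 1) - (of_nat ?q - of_nat p) / of_nat p"
      using defect_character[OF grp rep gc p0 exponent[OF gc]] by simp
    also have "\<dots> = complex_of_real (real ?q - real ?q / real p)"
      using G(3) p0 by (simp add: of_nat_diff diff_divide_distrib)
    finally have "complex_of_real (real (defect (?q - 1) (\<psi> g))) = complex_of_real (real ?q - real ?q / real p)"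
      by simp
    hence "real (defect (?q - 1) (\<psi> g)) = real ?q - real ?q / real p"
      by (simp only: of_real_eq_iff)
    thus ?thesis using G(3) by (simp add: c_def of_nat_diff)
  qed
  have "(\<lambda>g. rank_dist (?q - 1) (\<psi> g) (1\<^sub>m (?q - 1))) ` ?J = {c}"
    using J defect by (auto simp: rank_dist_def)
  hence min: "min_rank_dist G (?q - 1) \<psi> = c"
    using J unfolding min_rank_dist_def by (simp only: if_False Min_singleton)
  have "min_rank_dist G d \<phi> \<le> c" if \<phi>: "representation G d \<phi>" for d \<phi>
  proof -
    have d: "d > 0" using representationD(1)[OF grp \<phi>] by simp
    have "real (?q - 1) * (min_rank_dist G d \<phi> * real d) = (\<Sum>g\<in>?J. min_rank_dist G d \<phi> * real d)"
      by (simp add: cardJ)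
    also have "\<dots> \<le> (\<Sum>g\<in>?J. real (defect d (\<phi> g)))"
    proof (rule sum_mono)
      fix g assume "g \<in> ?J"
      hence "min_rank_dist G d \<phi> \<le> real (defect d (\<phi> g)) / real d"
        using min_rank_dist_le[OF G(2)] by simp
      thus "min_rank_dist G d \<phi> * real d \<le> real (defect d (\<phi> g))" using d by (simp add: field_simps)
    qed
    also have "\<dots> \<le> (\<Sum>g\<in>carrier G. real (defect d (\<phi> g)))"
      by (rule sum_mono2) (use G(2) in auto)
    also have "\<dots> \<le> real d * (real ?q - real ?q / real p)"
      by (rule sum_defect_exponent_le[OF G(1,2) p0 exponent \<phi>])
    finally have "real d * (min_rank_dist G d \<phi> * real (?q - 1)) \<le> real d * (real ?q - real ?q / real p)"
      by (simp only: mult_ac)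
    hence "min_rank_dist G d \<phi> * real (?q - 1) \<le> real ?q - real ?q / real p"
      using d by (simp only: mult_le_cancel_left_pos of_nat_0_less_iff)
    moreover have "real (?q - 1) = real ?q - 1" using G(3) by (simp add: of_nat_diff)
    ultimately have "min_rank_dist G d \<phi> * (real ?q - 1) \<le> real ?q - real ?q / real p" by simp
    thus ?thesis using G(3) by (simp add: c_def pos_le_divide_eq)
  qed
  hence "sofic_kappa G = min_rank_dist G (?q - 1) \<psi>"
    by (intro sofic_kappa_eq[OF grp G(2) rep]) (simp only: min)
  thus ?thesis by (simp only: min c_def)
qed

lemma comm_group_cyclic_power: "comm_group (cyclic_power p n)"
proof -
  have "group (cyclic_power p n)" by (simp add: cyclic_power_def)
  moreover have "x \<otimes>\<^bsub>cyclic_power p n\<^esub> y = y \<otimes>\<^bsub>cyclic_power p n\<^esub> x" for x y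
    by (simp add: cyclic_power_def add.commute)
  ultimately show ?thesis by (intro group.group_comm_groupI) auto
qed

lemma card_cyclic_power:
  assumes "p > 0"
  shows "finite (carrier (cyclic_power p n))" "card (carrier (cyclic_power p n)) = p ^ n"
  using assms by (auto simp: cyclic_power_def carrier_integer_mod_group card_PiE intro!: finite_PiE)

lemma cyclic_power_exponent:
  assumes x: "x \<in> carrier (cyclic_power p n)"
  shows "x [^]\<^bsub>cyclic_power p n\<^esub> p = \<one>\<^bsub>cyclic_power p n\<^esub>"
proof -
  have "x [^]\<^bsub>cyclic_power p n\<^esub> k = (\<lambda>i\<in>{..<n}. x i [^]\<^bsub>integer_mod_group p\<^esub> k)" for k :: nat
    by (induction k) (auto simp: cyclic_power_def fun_eq_iff nat_pow_def)
  thus ?thesis by (auto simp: cyclic_power_def)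
qed

lemma sofic_kappa_cyclic_power:
  assumes p: "Factorial_Ring.prime p" and n: "n \<ge> 1"
  shows "sofic_kappa (cyclic_power p n) = (real p ^ n - real p ^ (n - 1)) / (real p ^ n - 1)"
proof -
  have p1: "p > 1" using p by (rule prime_gt_1_nat)
  hence p0: "p > 0" by simp
  note card = card_cyclic_power[OF p0, of n]
  have "card (carrier (cyclic_power p n)) > 1" unfolding card(2) by (rule one_less_power) (use p1 n in auto)
  from sofic_kappa_elementary_abelian[OF comm_group_cyclic_power card(1) this p cyclic_power_exponent]
  show ?thesis using p0 n by (simp add: card(2) power_diff)
qed

theorem theorem2:
  fixes G :: "('a, 'b) monoid_scheme"
  assumes "group G" and "finite (carrier G)"
  shows "(\<exists>d \<psi>. representation G d \<psi> \<and> sofic_kappa G = min_rank_dist G d \<psi>)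
    \<and> sofic_kappa G \<in> \<rat>
    \<and> (sofic_kappa G = 1 \<longleftrightarrow> (\<exists>d \<psi>. representation G d \<psi> \<and> fixed_point_free G \<psi>))
    \<and> (\<forall>(p::nat) (n::nat). Factorial_Ring.prime p \<and> n \<ge> 2 \<longrightarrow>
        sofic_kappa (cyclic_power p n) = (real p ^ n - real p ^ (n - 1)) / (real p ^ n - 1))
    \<and> (\<lambda>n. sofic_kappa (cyclic_power 2 n)) \<longlonglongrightarrow> 1 / 2"
proof -
  obtain d \<psi> where rep: "representation G d \<psi>"
    and opt: "\<And>d' \<psi>'. representation G d' \<psi>' \<Longrightarrow> min_rank_dist G d' \<psi>' \<le> min_rank_dist G d \<psi>"
    using optimal_representation_exists[OF assms] by blast
  have eq: "sofic_kappa G = min_rank_dist G d \<psi>" by (rule sofic_kappa_eq[OF assms rep opt])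
  have one: "sofic_kappa G = 1 \<longleftrightarrow> (\<exists>d \<psi>. representation G d \<psi> \<and> fixed_point_free G \<psi>)"
  proof
    assume "sofic_kappa G = 1"
    thus "\<exists>d \<psi>. representation G d \<psi> \<and> fixed_point_free G \<psi>"
      using eq rep min_rank_dist_eq_1_iff[OF assms rep] by auto
  next
    assume "\<exists>d \<psi>. representation G d \<psi> \<and> fixed_point_free G \<psi>"
    then obtain d' \<psi>' where "representation G d' \<psi>'" "fixed_point_free G \<psi>'" by blast
    hence "1 \<le> min_rank_dist G d \<psi>"
      using opt min_rank_dist_eq_1_iff[OF assms] by metis
    thus "sofic_kappa G = 1" using eq min_rank_dist_le_1[OF assms(2), of d \<psi>] by simp
  qed
  have lim: "(\<lambda>n. sofic_kappa (cyclic_power 2 n)) \<longlonglongrightarrow> 1 / 2"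
  proof -
    have "(\<lambda>n. (1 / 2) / (1 - (1 / 2) ^ n) :: real) \<longlonglongrightarrow> (1 / 2) / (1 - 0)"
      by (intro tendsto_intros LIMSEQ_power_zero) auto
    hence "(\<lambda>n. (1 / 2) / (1 - (1 / 2) ^ n) :: real) \<longlonglongrightarrow> 1 / 2" by simp
    moreover have "\<forall>\<^sub>F n in sequentially. (1 / 2) / (1 - (1 / 2) ^ n) = sofic_kappa (cyclic_power 2 n)"
      unfolding eventually_sequentially
    proof (intro exI[of _ 1] allI impI)
      fix n :: nat assume n: "1 \<le> n"
      hence "(1::real) < 2 ^ n" by (intro one_less_power) auto
      thus "(1 / 2) / (1 - (1 / 2) ^ n) = sofic_kappa (cyclic_power 2 n)"
        using sofic_kappa_cyclic_power[OF two_is_prime_nat n] n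
        by (simp add: power_diff power_one_over field_simps)
    qed
    ultimately show ?thesis by (rule Lim_transform_eventually)
  qed
  show ?thesis
    using rep eq one lim sofic_kappa_cyclic_power min_rank_dist_in_Rats[OF assms(2), of d \<psi>]
    by (intro conjI exI[of _ d] exI[of _ \<psi>] allI impI) auto
qed

end
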